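(* With all notation as in the context, for every right coset $\tau\in G\backslash H$ and every $\alpha\in Q$ one has $$\gamma_1(\alpha\cdot\tau)=m(\alpha)\cdot\gamma_1(\tau).$$ In particular, the action of $Q$ on the blue $L$ cosets $\mathscr{O}_1$, and on the red $L$ cosets $\mathscr{O}_2$, is isomorphic (via $m$ and $\gamma_1$) to the action of $H_1$ on $G_L\backslash H_1$, and the action of $Q$ on the $J$ cosets $\mathscr{O}_3$ is isomorphic (via $m$ and $\gamma_1$) to the action of $H_1$ on $G_J\backslash H_1$.
   Context: Group $H$ side. Let $W=\{(a,b,c,d,e,f,g,h)^T\in\mathbb{C}^8: 2+3a=b+c+d+e+f+g+h\}$; a transposition $(ij)$ denotes the permutation matrix swapping coordinates $i,j$. Let $X\in GL(8,\mathbb{C})$ be the matrix with rows $(\tfrac12,\tfrac12,-\tfrac12,-\tfrac12,-\tfrac12,\tfrac12,\tfrac12,\tfrac12)$, $e_2$, $(-\tfrac12,\tfrac12,\tfrac12,-\tfrac12,-\tfrac12,\tfrac12,\tfrac12,\tfrac12)$, $(-\tfrac12,\tfrac12,-\tfrac12,\tfrac12,-\tfrac12,\tfrac12,\tfrac12,\tfrac12)$, $(-\tfrac12,\tfrac12,-\tfrac12,-\tfrac12,\tfrac12,\tfrac12,\tfrac12,\tfrac12)$, $e_6,e_7,e_8$, and $Y$ the matrix with rows $(-1,2,0,\dots,0)$, $(-1,1,1,0,\dots,0)$, $(0,1,0,\dots,0)$, and $-e_1+e_2+e_r$ ($r=4,\dots,8$). Let $H=\langle(23),(34),(45),(56),(67),(78),X,Y\rangle\cong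 W(E_7)$ with Coxeter generators $s_1=Y(23)$, $s_2=(34)$, $s_3=(45)$, $s_4=(56)$, $s_5=(67)$, $s_6=(78)$, $s_{3'}=X$; $G=\langle s_2,\dots,s_6,s_{3'}\rangle$; $Q=\langle s_1,\dots,s_5,s_{3'}\rangle$. For $\vec w\in W$ put $x_0=b,x_1=h,x_2=g,x_3=f,x_4=e,x_5=d,x_6=c,x_7=a$. The coset $G\alpha$ is determined by the second entry of $\alpha\vec w$ (an affine function of $\vec w$); $v(i,j)$ ($0\le i<j\le7$) is the coset with second entry $x_i+x_j-x_7$, and $-v(i,j)$ the one with $1+x_7-x_i-x_j$ (these are all 56 cosets). Let $\mathscr{O}_1=\{v(0,j),-v(1,j):2\le j\le7\}$ (blue $L$ cosets), $\mathscr{O}_2=\{v(1,j),-v(0,j):2\le j\le 7\}$ (red $L$ cosets), $\mathscr{O}_3=\{\pm v(0,1)\}\cup\{\pm v(i,j):2\le i<j\le7\}$ ($J$ cosets). Group $H_1$ side. Let $V=\{(A,B,C,D,E,F,G)^T\in\mathbb{C}^7:E+F+G-A-B-C-D=1\}$; let $X_1$ have rows $e_1$, $-e_3+e_5$, $-e_2+e_5$, $e_4$, $e_5$, $-e_2-e_3+e_5+e_6$, $-e_2-e_3+e_5+e_7$ (so $X_1\vec x=(A,E-C,E-B,D,E,1+A+D-G,1+A+D-F)^T$ on $V$). Let $H_1=\langle(12),(23),(34),(56),(67),X_1\rangle\cong W(D_6)$ with Coxeter generators $a_1=(23),a_2=(34),a_3=X_1,a_4=(56),a_5=(67),a_{1'}=(14)$,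 $G_J=\langle(23),(34),(56),(67),X_1\rangle$, $G_L=\langle(12),(23),(34),(67),(57)X_1(57)\rangle$. Labels of $G_J\backslash H_1$: the first coordinate of $\alpha\vec x$ ($\alpha\in H_1$) determines $G_J\alpha$; with $(A_0,A_1,A_2,A_3)=(A,B,C,D)$, $(E_0,E_1,E_2,E_3)=(1,E,F,G)$, it equals $1+A_r-E_q$ or $E_q-A_r$ ($0\le r,q\le3$). To the first case assign the sign string $b_rb_q$ (concatenation), where $b_0={+}{+}{+}$, $b_1={+}{-}{-}$, $b_2={-}{+}{-}$, $b_3={-}{-}{+}$; to the second case assign the negation of that string. This identifies $G_J\backslash H_1$ with the 32 length-6 sign strings with evenly many minus signs. Labels of $G_L\backslash H_1$: the coset labeled $\sigma\in\{1,\dots,6,\overline1,\dots,\overline6\}$ is $G_L\beta_\sigma$ where $\beta_\sigma\vec x=u_\sigma$ on $V$ with $u_6=(A,B,C,D,G,F,E)$, $u_5=(A,B,C,D,F,E,G)$, $u_4=(A,B,C,D,E,F,G)$, $u_3=(A,1+A-E,1+A-F,1+A-G,1+A-D,1+A-B,1+A-C)$, $u_2=(A,1+A-E,1+A-F,1+A-G,1+A-C,1+A-B,1+A-D)$, $u_1=(A,1+A-E,1+A-F,1+A-G,1+A-B,1+A-C,1+A-D)$, $u_{\overline6}=(1-A,1-B,1-C,1-D,2-G,2-F,2-E)$, $u_{\overline5}=(1-A,1-B,1-C,1-D,2-F,2-E,2-G)$, $u_{\overline4}=(1-A,1-B,1-C,1-D,2-E,2-F,2-G)$, $u_{\overline3}=(1-A,E-A,F-A,G-A,1+D-A,1+B-A,1+C-A)$,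 $u_{\overline2}=(1-A,E-A,F-A,G-A,1+C-A,1+B-A,1+D-A)$, $u_{\overline1}=(1-A,E-A,F-A,G-A,1+B-A,1+C-A,1+D-A)$. Maps. $m:Q\to H_1$ is the group isomorphism with $m(s_k)=a_{6-k}$ ($1\le k\le5$), $m(s_{3'})=a_{1'}$. The map $\gamma_1:G\backslash H\to (G_L\backslash H_1)\cup(G_J\backslash H_1)$ is: $\gamma_1(v(0,j))=\gamma_1(v(1,j))=j-1$ and $\gamma_1(-v(1,j))=\gamma_1(-v(0,j))=\overline{j-1}$ for $2\le j\le 7$; $\gamma_1(v(0,1))={+}{+}{+}{+}{+}{+}$, $\gamma_1(-v(0,1))={-}{-}{-}{-}{-}{-}$; for $2\le i<j\le7$, $\gamma_1(v(i,j))$ is the string with plus signs in positions $i-1$ and $j-1$ and minus signs elsewhere, and $\gamma_1(-v(i,j))$ is its negation. Actions: a group acts on right cosets of a subgroup by right multiplication, written $\alpha\cdot(K\beta)=K\beta\alpha^{-1}$. *)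

theory Defs
  imports "HOL-Analysis.Analysis"
begin

inductive_set gen_grp :: "('a::field ^'n ^'n) set \<Rightarrow> ('a ^'n ^'n) set"
  for S where
  gen_one: "mat 1 \<in> gen_grp S"
| gen_mul: "g \<in> gen_grp S \<Longrightarrow> s \<in> S \<Longrightarrow> g ** s \<in> gen_grp S"
| gen_inv: "g \<in> gen_grp S \<Longrightarrow> s \<in> S \<Longrightarrow> g ** matrix_inv s \<in> gen_grp S"

definition rcos :: "('a::semiring_1 ^'n ^'n) set \<Rightarrow> 'a ^'n ^'n \<Rightarrow> ('a ^'n ^'n) set" where
  "rcos K b = {k ** b | k. k \<in> K}"

definition rcosets_of :: "('a::semiring_1 ^'n ^'n) set \<Rightarrow> ('a ^'n ^'n) set \<Rightarrow> ('a ^'n ^'n) set set" where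
  "rcosets_of K Hg = {rcos K b | b. b \<in> Hg}"

definition act :: "'a::field ^'n ^'n \<Rightarrow> ('a ^'n ^'n) set \<Rightarrow> ('a ^'n ^'n) set" where
  "act a C = {c ** matrix_inv a | c. c \<in> C}"

definition tr :: "'n \<Rightarrow> 'n \<Rightarrow> complex ^'n ^'n" where
  "tr i j = (\<chi> r c. if c = Transposition.transpose i j r then 1 else 0)"

definition unitv :: "'n \<Rightarrow> complex ^'n" where
  "unitv k = (\<chi> i. if i = k then 1 else 0)"

definition W :: "(complex^8) set" where
  "W = {w. 2 + 3 * w$1 = w$2 + w$3 + w$4 + w$5 + w$6 + w$7 + w$8}"

definition Xm :: "complex^8^8" where
  "Xm = vector [
     vector [1/2, 1/2, -1/2, -1/2, -1/2, 1/2, 1/2, 1/2],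
     unitv 2,
     vector [-1/2, 1/2, 1/2, -1/2, -1/2, 1/2, 1/2, 1/2],
     vector [-1/2, 1/2, -1/2, 1/2, -1/2, 1/2, 1/2, 1/2],
     vector [-1/2, 1/2, -1/2, -1/2, 1/2, 1/2, 1/2, 1/2],
     unitv 6, unitv 7, unitv 8]"

definition Ym :: "complex^8^8" where
  "Ym = vector [
     vector [-1, 2, 0, 0, 0, 0, 0, 0],
     vector [-1, 1, 1, 0, 0, 0, 0, 0],
     vector [0, 1, 0, 0, 0, 0, 0, 0],
     - unitv 1 + unitv 2 + unitv 4,
     - unitv 1 + unitv 2 + unitv 5,
     - unitv 1 + unitv 2 + unitv 6,
     - unitv 1 + unitv 2 + unitv 7,
     - unitv 1 + unitv 2 + unitv 8]"

definition HH :: "(complex^8^8) set" where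
  "HH = gen_grp {tr 2 3, tr 3 4, tr 4 5, tr 5 6, tr 6 7, tr 7 8, Xm, Ym}"

definition s1 :: "complex^8^8" where "s1 = Ym ** tr 2 3"
definition s2 :: "complex^8^8" where "s2 = tr 3 4"
definition s3 :: "complex^8^8" where "s3 = tr 4 5"
definition s4 :: "complex^8^8" where "s4 = tr 5 6"
definition s5 :: "complex^8^8" where "s5 = tr 6 7"
definition s6 :: "complex^8^8" where "s6 = tr 7 8"
definition s3' :: "complex^8^8" where "s3' = Xm"

definition GG :: "(complex^8^8) set" where
  "GG = gen_grp {s2, s3, s4, s5, s6, s3'}"

definition QQ :: "(complex^8^8) set" where
  "QQ = gen_grp {s1, s2, s3, s4, s5, s3'}"

text \<open>Coordinates \<open>x_0 = b, x_1 = h, x_2 = g, x_3 = f, x_4 = e, x_5 = d, x_6 = c, x_7 = a\<close>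
  (with \<open>(a,\<dots>,h) = (w$1,\<dots>,w$8)\<close>).\<close>
definition xc :: "nat \<Rightarrow> complex^8 \<Rightarrow> complex" where
  "xc k w = (if k = 0 then w$2 else if k = 1 then w$8 else if k = 2 then w$7
     else if k = 3 then w$6 else if k = 4 then w$5 else if k = 5 then w$4
     else if k = 6 then w$3 else w$1)"

definition vpos :: "nat \<Rightarrow> nat \<Rightarrow> (complex^8^8) set" where
  "vpos i j = (THE C. \<exists>a\<in>HH. C = rcos GG a \<and>
      (\<forall>w\<in>W. (a *v w)$2 = xc i w + xc j w - xc 7 w))"

definition vneg :: "nat \<Rightarrow> nat \<Rightarrow> (complex^8^8) set" where
  "vneg i j = (THE C. \<exists>a\<in>HH. C = rcos GG a \<and>
      (\<forall>w\<in>W. (a *v w)$2 = 1 + xc 7 w - xc i w - xc j w))"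

definition O1 :: "(complex^8^8) set set" where
  "O1 = {vpos 0 j | j. 2 \<le> j \<and> j \<le> 7} \<union> {vneg 1 j | j. 2 \<le> j \<and> j \<le> 7}"

definition O2 :: "(complex^8^8) set set" where
  "O2 = {vpos 1 j | j. 2 \<le> j \<and> j \<le> 7} \<union> {vneg 0 j | j. 2 \<le> j \<and> j \<le> 7}"

definition O3 :: "(complex^8^8) set set" where
  "O3 = {vpos 0 1, vneg 0 1} \<union> {vpos i j | i j. 2 \<le> i \<and> i < j \<and> j \<le> 7}
        \<union> {vneg i j | i j. 2 \<le> i \<and> i < j \<and> j \<le> 7}"

definition V :: "(complex^7) set" where
  "V = {x. x$5 + x$6 + x$7 - x$1 - x$2 - x$3 - x$4 = 1}"

definition X1 :: "complex^7^7" where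
  "X1 = vector [unitv 1, - unitv 3 + unitv 5, - unitv 2 + unitv 5, unitv 4, unitv 5,
                - unitv 2 - unitv 3 + unitv 5 + unitv 6, - unitv 2 - unitv 3 + unitv 5 + unitv 7]"

definition H1 :: "(complex^7^7) set" where
  "H1 = gen_grp {tr 1 2, tr 2 3, tr 3 4, tr 5 6, tr 6 7, X1}"

definition a1 :: "complex^7^7" where "a1 = tr 2 3"
definition a2 :: "complex^7^7" where "a2 = tr 3 4"
definition a3 :: "complex^7^7" where "a3 = X1"
definition a4 :: "complex^7^7" where "a4 = tr 5 6"
definition a5 :: "complex^7^7" where "a5 = tr 6 7"
definition a1' :: "complex^7^7" where "a1' = tr 1 4"

definition GJ :: "(complex^7^7) set" where
  "GJ = gen_grp {tr 2 3, tr 3 4, tr 5 6, tr 6 7, X1}"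

definition GL :: "(complex^7^7) set" where
  "GL = gen_grp {tr 1 2, tr 2 3, tr 3 4, tr 6 7, tr 5 7 ** X1 ** tr 5 7}"

text \<open>\<open>(A_0,A_1,A_2,A_3) = (A,B,C,D)\<close>, \<open>(E_0,E_1,E_2,E_3) = (1,E,F,G)\<close>.\<close>
definition Ac :: "nat \<Rightarrow> complex^7 \<Rightarrow> complex" where
  "Ac r x = (if r = 0 then x$1 else if r = 1 then x$2 else if r = 2 then x$3 else x$4)"

definition Ec :: "nat \<Rightarrow> complex^7 \<Rightarrow> complex" where
  "Ec q x = (if q = 0 then 1 else if q = 1 then x$5 else if q = 2 then x$6 else x$7)"

text \<open>Sign strings as lists of \<open>1\<close> (plus) and \<open>-1\<close> (minus); \<open>b_r\<close>.\<close>
definition bs :: "nat \<Rightarrow> int list" where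
  "bs r = (if r = 0 then [1,1,1] else if r = 1 then [1,-1,-1]
           else if r = 2 then [-1,1,-1] else [-1,-1,1])"

definition negs :: "int list \<Rightarrow> int list" where
  "negs s = map uminus s"

definition Jcos :: "int list \<Rightarrow> (complex^7^7) set" where
  "Jcos s = (THE C. \<exists>b\<in>H1. C = rcos GJ b \<and>
     ((\<exists>r q. r \<le> 3 \<and> q \<le> 3 \<and> s = bs r @ bs q \<and> (\<forall>x\<in>V. (b *v x)$1 = 1 + Ac r x - Ec q x))
    \<or> (\<exists>r q. r \<le> 3 \<and> q \<le> 3 \<and> s = negs (bs r @ bs q) \<and> (\<forall>x\<in>V. (b *v x)$1 = Ec q x - Ac r x))))"

text \<open>\<open>u_\<sigma>\<close>; the label \<open>k\<close> is encoded as \<open>k\<close>, the label \<open>\<overline>k\<close> as \<open>-k\<close>.\<close>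
definition uL :: "int \<Rightarrow> complex^7 \<Rightarrow> complex^7" where
  "uL s x = (let A = x$1; B = x$2; C = x$3; D = x$4; E = x$5; F = x$6; G = x$7 in
     if s = 6 then vector [A,B,C,D,G,F,E]
     else if s = 5 then vector [A,B,C,D,F,E,G]
     else if s = 4 then vector [A,B,C,D,E,F,G]
     else if s = 3 then vector [A,1+A-E,1+A-F,1+A-G,1+A-D,1+A-B,1+A-C]
     else if s = 2 then vector [A,1+A-E,1+A-F,1+A-G,1+A-C,1+A-B,1+A-D]
     else if s = 1 then vector [A,1+A-E,1+A-F,1+A-G,1+A-B,1+A-C,1+A-D]
     else if s = -6 then vector [1-A,1-B,1-C,1-D,2-G,2-F,2-E]
     else if s = -5 then vector [1-A,1-B,1-C,1-D,2-F,2-E,2-G]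
     else if s = -4 then vector [1-A,1-B,1-C,1-D,2-E,2-F,2-G]
     else if s = -3 then vector [1-A,E-A,F-A,G-A,1+D-A,1+B-A,1+C-A]
     else if s = -2 then vector [1-A,E-A,F-A,G-A,1+C-A,1+B-A,1+D-A]
     else vector [1-A,E-A,F-A,G-A,1+B-A,1+C-A,1+D-A])"

definition Lcos :: "int \<Rightarrow> (complex^7^7) set" where
  "Lcos s = (THE C. \<exists>b\<in>H1. C = rcos GL b \<and> (\<forall>x\<in>V. b *v x = uL s x))"

definition mm :: "complex^8^8 \<Rightarrow> complex^7^7" where
  "mm = (SOME f. bij_betw f QQ H1 \<and> (\<forall>x\<in>QQ. \<forall>y\<in>QQ. f (x ** y) = f x ** f y)
          \<and> f s1 = a5 \<and> f s2 = a4 \<and> f s3 = a3 \<and> f s4 = a2 \<and> f s5 = a1 \<and> f s3' = a1')"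

definition pstr :: "nat \<Rightarrow> nat \<Rightarrow> int list" where
  "pstr i j = map (\<lambda>p. if p = i - 1 \<or> p = j - 1 then 1 else -1) [1..<7]"

definition gamma1 :: "(complex^8^8) set \<Rightarrow> (complex^7^7) set" where
  "gamma1 t = (THE K.
       (\<exists>j. 2 \<le> j \<and> j \<le> 7 \<and> (t = vpos 0 j \<or> t = vpos 1 j) \<and> K = Lcos (int j - 1))
     \<or> (\<exists>j. 2 \<le> j \<and> j \<le> 7 \<and> (t = vneg 1 j \<or> t = vneg 0 j) \<and> K = Lcos (- (int j - 1)))
     \<or> (t = vpos 0 1 \<and> K = Jcos [1,1,1,1,1,1])
     \<or> (t = vneg 0 1 \<and> K = Jcos [-1,-1,-1,-1,-1,-1])
     \<or> (\<exists>i j. 2 \<le> i \<and> i < j \<and> j \<le> 7 \<and> t = vpos i j \<and> K = Jcos (pstr i j))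
     \<or> (\<exists>i j. 2 \<le> i \<and> i < j \<and> j \<le> 7 \<and> t = vneg i j \<and> K = Jcos (negs (pstr i j))))"

end

theory Submission
  imports Defs
begin

text \<open>
  A right coset is recorded by a row vector: \<open>G\<alpha>\<close> by the second row of \<open>\<alpha>\<close>, \<open>G\<^sub>J\<beta>\<close> by (twice) the
  first row of \<open>\<beta>\<close>, and \<open>G\<^sub>L\<beta>\<close> by the image under \<open>\<beta>\<close> of the functional \<open>F + G - E\<close>, which \<open>G\<^sub>L\<close>
  fixes. That the row determines the coset is seen on minimal coset representatives: for such a
  representative \<open>r\<close> and a Coxeter generator \<open>s\<close> of the big group, either \<open>rs\<close> is again a
  representative or \<open>rs = tr\<close> for a Coxeter generator \<open>t\<close> of the subgroup, and the representatives
  have different rows.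

  The isomorphism \<open>m\<close> and the map \<open>\<gamma>\<^sub>1\<close> come from one linear map \<open>down\<close> from rows of length 8 to rows
  of length 7 with \<open>a down = down m(a)\<close> for all \<open>a \<in> Q\<close>: on rows, \<open>\<gamma>\<^sub>1\<close> is multiplication by \<open>down\<close>,
  so it is equivariant. The group \<open>Q\<close> also fixes the functional \<open>r \<mapsto> r$2 - r$8\<close> on rows, whose values
  1, -1, 0 on the 56 coset rows single out the blue, red and \<open>J\<close> cosets.
\<close>

section \<open>Generated groups and cosets as fibres of a row\<close>

lemma matrix_inv_unique:
  fixes g h :: "'a::field^'n^'n"
  assumes "g ** h = mat 1" "h ** g = mat 1"
  shows "matrix_inv g = h"
proof -
  have "g ** matrix_inv g = mat 1 \<and> matrix_inv g ** g = mat 1"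
    unfolding matrix_inv_def by (rule someI_ex) (use assms in blast)
  then have "matrix_inv g = matrix_inv g ** g ** h"
    using assms by (metis matrix_mul_assoc matrix_mul_rid)
  then show ?thesis
    using \<open>_ \<and> _\<close> by simp
qed

text \<open>An involution is its own inverse, so an induction over a group generated by Coxeter
  generators has a single step case.\<close>

definition involutive :: "('a::field^'n^'n) set \<Rightarrow> bool" where
  "involutive S \<longleftrightarrow> (\<forall>s\<in>S. s ** s = mat 1)"

lemma gen_grp_incl: "s \<in> S \<Longrightarrow> s \<in> gen_grp S"
  using gen_mul[OF gen_one] by fastforce

lemma gen_grp_mult:
  assumes "g \<in> gen_grp S" "h \<in> gen_grp S"
  shows "g ** h \<in> gen_grp S"
  using assms(2)
  by (induction rule: gen_grp.induct) (auto simp: assms(1) matrix_mul_assoc intro: gen_grp.intros)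

lemma gen_grp_involutive_induct [consumes 2, case_names one mult]:
  assumes "g \<in> gen_grp S" "involutive S"
    and "P (mat 1)" "\<And>g s. g \<in> gen_grp S \<Longrightarrow> P g \<Longrightarrow> s \<in> S \<Longrightarrow> P (g ** s)"
  shows "P g"
  using assms(1)
proof (induction rule: gen_grp.induct)
  case (gen_inv g s)
  then show ?case
    using assms(2,4) matrix_inv_unique[of s s] by (simp add: involutive_def)
qed (use assms in auto)

lemma gen_grp_has_inverse:
  assumes "g \<in> gen_grp S" "involutive S"
  shows "\<exists>h \<in> gen_grp S. g ** h = mat 1 \<and> h ** g = mat 1"
  using assms
proof (induction rule: gen_grp_involutive_induct)
  case one
  then show ?case
    by (auto intro: gen_one)
next
  case (mult g s)
  then obtain h where h: "h \<in> gen_grp S" "g ** h = mat 1" "h ** g = mat 1"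
    by blast
  have s: "s ** s = mat 1"
    using assms mult.hyps by (simp add: involutive_def)
  have "g ** s ** (s ** h) = g ** (s ** s) ** h" "s ** h ** (g ** s) = s ** (h ** g) ** s"
    by (simp_all add: matrix_mul_assoc)
  then show ?case
    using h s mult.hyps by (metis gen_grp_incl gen_grp_mult matrix_mul_rid)
qed

lemma gen_grp_inverse:
  assumes "involutive S" "g \<in> gen_grp S"
  shows "matrix_inv g \<in> gen_grp S" "g ** matrix_inv g = mat 1" "matrix_inv g ** g = mat 1"
  using gen_grp_has_inverse[OF assms(2,1)] matrix_inv_unique by metis+

text \<open>Inverted generators are harmless in two ways: involutions in \<open>T\<close> are their
  own inverses, and a group generated by involutions \<open>S\<close> contains all inverses. The
  second way covers \<open>Ym\<close>, which is not an involution.\<close>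

lemma gen_grp_subset:
  assumes "T \<subseteq> gen_grp S" "involutive T \<or> involutive S"
  shows "gen_grp T \<subseteq> gen_grp S"
proof
  fix g assume "g \<in> gen_grp T"
  then show "g \<in> gen_grp S"
  proof induction
    case (gen_inv g s)
    then have "matrix_inv s \<in> gen_grp S"
      using assms gen_grp_inverse(1) matrix_inv_unique[of s s] by (auto simp: involutive_def)
    then show ?case
      using gen_inv gen_grp_mult by blast
  qed (use assms in \<open>auto intro: gen_one gen_grp_mult\<close>)
qed

lemma gen_grp_eqI:
  assumes "T \<subseteq> gen_grp S" "S \<subseteq> gen_grp T" "involutive S"
  shows "gen_grp T = gen_grp S"
  using assms gen_grp_subset by blast

definition fib :: "('a::field^'n^'n) set \<Rightarrow> 'a^'n \<Rightarrow> 'a^'n \<Rightarrow> ('a^'n^'n) set" where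
  "fib H phi r = {a \<in> H. phi v* a = r}"

text \<open>An element \<open>b\<close> of the new fibre is \<open>b ** a ** matrix_inv a\<close>
  with \<open>b ** a\<close> in the old one. The action on cosets thus becomes the linear action on
  rows.\<close>

lemma act_fib:
  assumes "involutive S" "a \<in> gen_grp S"
  shows "act a (fib (gen_grp S) phi r) = fib (gen_grp S) phi (r v* matrix_inv a)"
proof -
  note a = gen_grp_inverse[OF assms]
  have "b \<in> act a (fib (gen_grp S) phi r)"
    if "b \<in> gen_grp S" "phi v* b = r v* matrix_inv a" for b
  proof -
    have "b = b ** a ** matrix_inv a" "phi v* (b ** a) = r"
      using that a by (metis matrix_mul_assoc matrix_mul_rid,
          metis vector_matrix_mul_assoc vector_matrix_mul_rid)
    then show ?thesis
      using that assms by (auto simp: act_def fib_def intro: gen_grp_mult)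
  qed
  then show ?thesis
    using a by (auto simp: act_def fib_def vector_matrix_mul_assoc[symmetric] intro: gen_grp_mult)
qed

text \<open>The assumption \<open>step\<close> is Deodhar's dichotomy for minimal coset
  representatives. Together with \<open>distinct\<close> it makes \<open>gen_grp T\<close> the whole
  stabilizer of \<open>phi\<close>, although \<open>fixed\<close> speaks of generators only.\<close>

locale row_stabilizer =
  fixes S T R :: "('a::field^'n^'n) set" and phi :: "'a^'n"
  assumes involutive: "involutive S"
    and sub: "T \<subseteq> S"
    and fixed: "t \<in> T \<Longrightarrow> phi v* t = phi"
    and mat_1: "mat 1 \<in> R"
    and reps: "R \<subseteq> gen_grp S"
    and step: "r \<in> R \<Longrightarrow> s \<in> S \<Longrightarrow> r ** s \<in> R \<or> (\<exists>t\<in>T. r ** s = t ** r)"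
    and distinct: "r \<in> R \<Longrightarrow> r' \<in> R \<Longrightarrow> phi v* r = phi v* r' \<Longrightarrow> r = r'"
begin

lemma involutive_T: "involutive T"
  using involutive sub by (auto simp: involutive_def)

lemma subgroup: "gen_grp T \<subseteq> gen_grp S"
  by (rule gen_grp_subset) (use involutive_T sub gen_grp_incl in blast)+

lemma subgroup_fixes:
  assumes "k \<in> gen_grp T"
  shows "phi v* k = phi"
  using assms involutive_T
proof (induction rule: gen_grp_involutive_induct)
  case (mult g s)
  then show ?case
    using fixed by (metis vector_matrix_mul_assoc)
qed simp

text \<open>A word is read letter by letter: each new letter either extends the representative
  inside \<open>R\<close> or crosses it by \<open>step\<close> and joins the subgroup
  factor.\<close>

lemma factor:
  assumes "a \<in> gen_grp S"
  shows "\<exists>k \<in> gen_grp T. \<exists>r \<in> R. a = k ** r"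
  using assms involutive
proof (induction rule: gen_grp_involutive_induct)
  case one
  then show ?case
    using mat_1 gen_one[of T] matrix_mul_rid[of "mat 1"] by metis
next
  case (mult g s)
  then obtain k r where kr: "k \<in> gen_grp T" "r \<in> R" "g = k ** r"
    by blast
  from step[OF kr(2) mult.hyps(2)] show ?case
  proof
    assume "r ** s \<in> R"
    then show ?thesis
      using kr by (metis matrix_mul_assoc)
  next
    assume "\<exists>t\<in>T. r ** s = t ** r"
    then obtain t where "t \<in> T" "r ** s = t ** r"
      by blast
    then have "k ** t \<in> gen_grp T" "g ** s = k ** t ** r"
      using kr by (auto intro: gen_mul) (metis matrix_mul_assoc)
    then show ?thesis
      using kr by blast
  qed
qed

text \<open>Factor \<open>a = k ** r\<close> and \<open>b = k' ** r'\<close>. Since \<open>k\<close>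
  and \<open>k'\<close> fix \<open>phi\<close>, equal rows force \<open>r = r'\<close>, and then
  \<open>b = k' ** matrix_inv k ** a\<close>.\<close>

lemma rcos_eq_fib:
  assumes "a \<in> gen_grp S"
  shows "rcos (gen_grp T) a = fib (gen_grp S) phi (phi v* a)"
proof
  show "rcos (gen_grp T) a \<subseteq> fib (gen_grp S) phi (phi v* a)"
    using assms subgroup subgroup_fixes
    by (auto simp: rcos_def fib_def vector_matrix_mul_assoc[symmetric] intro: gen_grp_mult)
  show "fib (gen_grp S) phi (phi v* a) \<subseteq> rcos (gen_grp T) a"
  proof
    fix b assume "b \<in> fib (gen_grp S) phi (phi v* a)"
    then have b: "b \<in> gen_grp S" "phi v* b = phi v* a"
      by (auto simp: fib_def)
    obtain k r where kr: "k \<in> gen_grp T" "r \<in> R" "a = k ** r"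
      using factor assms by blast
    obtain k' r' where kr': "k' \<in> gen_grp T" "r' \<in> R" "b = k' ** r'"
      using factor b by blast
    have "phi v* r' = phi v* r"
      using b(2) kr kr' subgroup_fixes by (simp add: vector_matrix_mul_assoc[symmetric])
    then have "r' = r"
      using distinct kr kr' by blast
    note k = gen_grp_inverse[OF involutive_T kr(1)]
    have "b = (k' ** matrix_inv k) ** a"
    proof -
      have "(k' ** matrix_inv k) ** a = k' ** (matrix_inv k ** k) ** r"
        using kr by (simp add: matrix_mul_assoc)
      then show ?thesis
        using k kr' \<open>r' = r\<close> by simp
    qed
    then show "b \<in> rcos (gen_grp T) a"
      using kr' k gen_grp_mult unfolding rcos_def by blast
  qed
qed

lemma rows: "(\<lambda>a. phi v* a) ` gen_grp S = (\<lambda>a. phi v* a) ` R"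
proof
  show "(\<lambda>a. phi v* a) ` gen_grp S \<subseteq> (\<lambda>a. phi v* a) ` R"
    using factor subgroup_fixes by (force simp: vector_matrix_mul_assoc[symmetric])
qed (use reps in auto)

lemma rcosets_eq: "rcosets_of (gen_grp T) (gen_grp S) = fib (gen_grp S) phi ` (\<lambda>a. phi v* a) ` R"
  unfolding rows[symmetric] rcosets_of_def using rcos_eq_fib by auto

lemma fib_inj: "inj_on (fib (gen_grp S) phi) ((\<lambda>a. phi v* a) ` R)"
  using reps by (force simp: inj_on_def fib_def)

text \<open>\<open>vpos\<close>, \<open>vneg\<close>, \<open>Jcos\<close> and \<open>Lcos\<close>
  all describe a coset by a property of one member. It suffices that the property is attained and
  that it forces the row.\<close>

lemma the_rcos:
  assumes "\<exists>a \<in> gen_grp S. Q a" "\<And>a. a \<in> gen_grp S \<Longrightarrow> Q a \<Longrightarrow> phi v* a = r"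
  shows "(THE C. \<exists>a \<in> gen_grp S. C = rcos (gen_grp T) a \<and> Q a) = fib (gen_grp S) phi r"
  using assms rcos_eq_fib by (intro the_equality) auto

end

section \<open>Coset representatives as integer matrices\<close>

fun lin_comb :: "('a::ring_1^'n) list \<Rightarrow> int list \<Rightarrow> 'a^'n" where
  "lin_comb (b # B) (c # cs) = of_int c *s b + lin_comb B cs"
| "lin_comb _ _ = 0"

text \<open>Missing trailing entries count as zeros, so that no length conditions are needed.\<close>
fun row_add :: "int list \<Rightarrow> int list \<Rightarrow> int list" where
  "row_add [] ys = ys"
| "row_add xs [] = xs"
| "row_add (x # xs) (y # ys) = (x + y) # row_add xs ys"

text \<open>Skipping zero coefficients shortens the evaluation of sparse products. A zero row comes
  out as the empty list, which \<open>lin_comb\<close> also sends to 0.\<close>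

fun row_mult :: "int list \<Rightarrow> int list list \<Rightarrow> int list" where
  "row_mult (c # cs) (r # rs) =
     (if c = 0 then row_mult cs rs else row_add (map ((*) c) r) (row_mult cs rs))"
| "row_mult _ _ = []"

definition mat_mult :: "int list list \<Rightarrow> int list list \<Rightarrow> int list list" where
  "mat_mult M N = map (\<lambda>r. row_mult r N) M"

text \<open>Matrices act on rows from the right, so products keep their order. The two bases differ
  for \<open>down\<close>, which goes from rows of length 8 to rows of length 7.\<close>

definition represents ::
  "('a::field^'n) list \<Rightarrow> ('a^'m) list \<Rightarrow> int list list \<Rightarrow> 'a^'m^'n \<Rightarrow> bool" where
  "represents B B' M A \<longleftrightarrow> map (\<lambda>b. b v* A) B = map (lin_comb B') M"

lemma lin_comb_Nil [simp]: "lin_comb B [] = 0"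
  by (cases B) auto

lemma lin_comb_row_add: "lin_comb B (row_add xs ys) = lin_comb B xs + lin_comb B ys"
proof (induction xs ys arbitrary: B rule: row_add.induct)
  case (3 x xs y ys)
  then show ?case
    by (cases B) (auto simp: vector_sadd_rdistrib)
qed auto

lemma lin_comb_scale: "lin_comb B (map ((*) c) xs) = of_int c *s lin_comb B xs"
  by (induction B xs rule: lin_comb.induct) (auto simp: vector_add_ldistrib vector_smult_assoc)

lemma lin_comb_vector_matrix_mult:
  assumes "represents B B' M A"
  shows "lin_comb B c v* A = lin_comb B' (row_mult c M)"
  using assms
proof (induction c M arbitrary: B rule: row_mult.induct)
  case (1 c cs r rs)
  then show ?case
    by (cases B) (auto simp: represents_def lin_comb_row_add lin_comb_scale
        vector_matrix_left_distrib scalar_vector_matrix_assoc)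
qed (auto simp: represents_def)

lemma represents_mult:
  assumes "represents B B' M A" "represents B' B'' N A'"
  shows "represents B B'' (mat_mult M N) (A ** A')"
proof -
  have "map (\<lambda>b. b v* (A ** A')) B = map (\<lambda>v. v v* A') (map (\<lambda>b. b v* A) B)"
    by (simp add: vector_matrix_mul_assoc)
  then show ?thesis
    using assms(1) lin_comb_vector_matrix_mult[OF assms(2)]
    unfolding represents_def mat_mult_def by (simp add: comp_def del: map_eq_conv)
qed

text \<open>
  The last argument is a Schreier tree: its entry \<open>(p, g)\<close> appends the product of the \<open>p\<close>-th
  representative found so far with the \<open>g\<close>-th generator.
\<close>
fun transversal ::
  "int list list list \<Rightarrow> int list list list \<Rightarrow> (nat \<times> nat) list \<Rightarrow> int list list list" where
  "transversal gs Ms [] = Ms"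
| "transversal gs Ms ((p, g) # ps) =
     transversal gs
       (if p < length Ms \<and> g < length gs then Ms @ [mat_mult (Ms ! p) (gs ! g)] else Ms) ps"

text \<open>The first generator is the one outside the subgroup, the others generate the subgroup.\<close>
definition schreier_closed :: "int list list list \<Rightarrow> int list list list \<Rightarrow> bool" where
  "schreier_closed gs Ms \<longleftrightarrow> list_all (\<lambda>M. list_all (\<lambda>g.
     let N = mat_mult M g in List.member Ms N \<or> list_ex (\<lambda>t. N = mat_mult t M) (tl gs)) gs) Ms"

definition id_rows :: "nat \<Rightarrow> int list list" where
  "id_rows n = map (\<lambda>i. map (\<lambda>j. if i = j then 1 else 0) [0..<n]) [0..<n]"

lemma list_all2_obtain:
  assumes "list_all2 P xs ys"
  shows "x \<in> set xs \<Longrightarrow> \<exists>y \<in> set ys. P x y" and "y \<in> set ys \<Longrightarrow> \<exists>x \<in> set xs. P x y"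
  using assms by (induction rule: list_all2_induct) auto

text \<open>The finite group theory is pushed into integer lists: \<open>squares\<close>,
  \<open>closed\<close>, \<open>row_distinct\<close>, \<open>row_length\<close> and
  \<open>row_fixed\<close> can be evaluated, while \<open>gens\<close>, \<open>separating\<close>,
  \<open>independent\<close> and \<open>id_rows\<close> tie the lists to complex matrices.\<close>

locale schreier_model =
  fixes B :: "(complex^'n) list" and As :: "(complex^'n^'n) list"
    and gs :: "int list list list" and f :: "int list" and ps :: "(nat \<times> nat) list"
    and Ms :: "int list list list"
  assumes Ms_def: "Ms = transversal gs [id_rows (length B)] ps"
    and squares: "list_all (\<lambda>g. mat_mult g g = id_rows (length B)) gs"
    and gens: "list_all2 (represents B B) gs As"
    and separating: "(\<And>b. b \<in> set B \<Longrightarrow> b v* A = b v* A') \<Longrightarrow> A = (A' :: complex^'n^'n)"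
    and independent: "inj_on (lin_comb B) {xs. length xs = length B}"
    and id_rows: "represents B B (id_rows (length B)) (mat 1)"
    and closed: "schreier_closed gs Ms"
    and row_distinct: "distinct (map (row_mult f) Ms)"
    and row_length: "list_all (\<lambda>M. length (row_mult f M) = length B) Ms"
    and row_fixed: "list_all (\<lambda>g. row_mult f g = f) (tl gs)"
begin

definition "R = {a \<in> gen_grp (set As). \<exists>M \<in> set Ms. represents B B M a}"

lemma represents_unique:
  assumes "represents B B M a" "represents B B M a'"
  shows "a = a'"
proof (rule separating)
  have "map (\<lambda>b. b v* a) B = map (\<lambda>b. b v* a') B"
    using assms unfolding represents_def by simp
  then show "b v* a = b v* a'" if "b \<in> set B" for b
    using that by simp
qed

lemma transversal_realized:
  assumes "M \<in> set (transversal gs Ns qs)"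
    and "\<And>M. M \<in> set Ns \<Longrightarrow> \<exists>a \<in> gen_grp (set As). represents B B M a"
  shows "\<exists>a \<in> gen_grp (set As). represents B B M a"
  using assms
proof (induction qs arbitrary: Ns)
  case (Cons q qs)
  obtain p g where q: "q = (p, g)"
    by (cases q)
  have "\<exists>a \<in> gen_grp (set As). represents B B (mat_mult (Ns ! p) (gs ! g)) a"
    if pg: "p < length Ns" "g < length gs"
  proof -
    obtain a where "a \<in> gen_grp (set As)" "represents B B (Ns ! p) a"
      using Cons.prems(2)[OF nth_mem[OF pg(1)]] by blast
    moreover have "As ! g \<in> set As" "represents B B (gs ! g) (As ! g)"
      using gens that by (auto simp: list_all2_conv_all_nth)
    ultimately show ?thesis
      using represents_mult gen_mul by blast
  qed
  then show ?case
    using Cons.prems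
    by (intro Cons.IH[of "if p < length Ns \<and> g < length gs
          then Ns @ [mat_mult (Ns ! p) (gs ! g)] else Ns"])
      (auto simp: q split: if_splits)
qed auto

lemma Ms_realized: "M \<in> set Ms \<Longrightarrow> \<exists>a \<in> R. represents B B M a"
proof -
  assume M: "M \<in> set Ms"
  have "\<exists>a \<in> gen_grp (set As). represents B B M a"
    using M unfolding Ms_def
    by (rule transversal_realized) (use id_rows gen_one in auto)
  then show ?thesis
    using M by (auto simp: R_def)
qed

lemma phi_mult: "represents B B M a \<Longrightarrow> lin_comb B f v* a = lin_comb B (row_mult f M)"
  by (rule lin_comb_vector_matrix_mult)

lemma tl_gens: "list_all2 (represents B B) (tl gs) (tl As)"
  using gens by (cases gs; cases As) auto

sublocale row_stabilizer "set As" "set (tl As)" R "lin_comb B f"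
proof
  show "involutive (set As)"
    unfolding involutive_def
  proof
    fix s assume s: "s \<in> set As"
    obtain g where "g \<in> set gs" "represents B B g s"
      using list_all2_obtain(2)[OF gens s] by blast
    then show "s ** s = mat 1"
      using represents_mult[of B B g s B g s] squares id_rows represents_unique
      by (auto simp: list_all_iff)
  qed
  show "R \<subseteq> gen_grp (set As)"
    by (auto simp: R_def)
  show "set (tl As) \<subseteq> set As"
    by (cases As) auto
  show "mat 1 \<in> R"
  proof -
    \<comment> \<open>The list of representatives only grows, so the starting identity matrix stays
      in it.\<close>
    have "M \<in> set (transversal hs Ns qs)" if "M \<in> set Ns" for M hs Ns qs
      using that by (induction hs Ns qs rule: transversal.induct) auto
    then have "id_rows (length B) \<in> set Ms"
      by (simp add: Ms_def)
    then show ?thesis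
      using id_rows gen_one by (auto simp: R_def)
  qed
  show "lin_comb B f v* t = lin_comb B f" if t: "t \<in> set (tl As)" for t
  proof -
    obtain g where "g \<in> set (tl gs)" "represents B B g t"
      using list_all2_obtain(2)[OF tl_gens t] by blast
    then show ?thesis
      using row_fixed phi_mult by (auto simp: list_all_iff)
  qed
  show "r ** s \<in> R \<or> (\<exists>t\<in>set (tl As). r ** s = t ** r)" if "r \<in> R" "s \<in> set As" for r s
  proof -
    obtain M where M: "M \<in> set Ms" "represents B B M r" and r: "r \<in> gen_grp (set As)"
      using \<open>r \<in> R\<close> by (auto simp: R_def)
    obtain g where g: "g \<in> set gs" "represents B B g s"
      using list_all2_obtain(2)[OF gens \<open>s \<in> set As\<close>] by blast
    note rs = represents_mult[OF M(2) g(2)]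
    have "mat_mult M g \<in> set Ms \<or> (\<exists>t \<in> set (tl gs). mat_mult M g = mat_mult t M)"
      using closed M g by (auto simp: schreier_closed_def list_all_iff list_ex_iff Let_def)
    then show ?thesis
    proof
      assume "mat_mult M g \<in> set Ms"
      then show ?thesis
        using rs r that gen_mul by (auto simp: R_def)
    next
      assume "\<exists>t \<in> set (tl gs). mat_mult M g = mat_mult t M"
      then obtain t where t: "t \<in> set (tl gs)" "mat_mult M g = mat_mult t M"
        by blast
      then obtain t' where "t' \<in> set (tl As)" "represents B B t t'"
        using list_all2_obtain(1)[OF tl_gens] by blast
      then show ?thesis
        using represents_mult[OF _ M(2)] represents_unique rs t by metis
    qed
  qed
  show "r = r'" if r: "r \<in> R" "r' \<in> R" and eq: "lin_comb B f v* r = lin_comb B f v* r'" for r r'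
  proof -
    obtain M where M: "M \<in> set Ms" "represents B B M r"
      using r by (auto simp: R_def)
    obtain M' where M': "M' \<in> set Ms" "represents B B M' r'"
      using r by (auto simp: R_def)
    \<comment> \<open>Independence is stated for lists of full length, since trailing zeros do not
      change a combination; \<open>row_length\<close> provides that length.\<close>
    have "row_mult f M = row_mult f M'"
      using eq row_length M M' independent
      by (auto simp: phi_mult[OF M(2)] phi_mult[OF M'(2)] inj_on_def list_all_iff)
    then have "M = M'"
      using row_distinct M M' by (auto simp: distinct_map inj_on_def)
    then show ?thesis
      using M M' represents_unique by blast
  qed
qed

lemma rows_eq: "(\<lambda>a. lin_comb B f v* a) ` R = lin_comb B ` set (map (row_mult f) Ms)"
proof -
  have "(\<lambda>a. lin_comb B f v* a) ` R \<subseteq> lin_comb B ` set (map (row_mult f) Ms)"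
    using phi_mult by (auto simp: R_def)
  moreover have "lin_comb B (row_mult f M) \<in> (\<lambda>a. lin_comb B f v* a) ` R" if "M \<in> set Ms" for M
    using Ms_realized[OF that] phi_mult by (metis imageI)
  ultimately show ?thesis
    by auto
qed

text \<open>Serves membership proofs by an explicit word of generator positions, whose product is
  evaluated on integer matrices.\<close>

lemma word_realized:
  assumes "list_all (\<lambda>g. g < length gs) w"
  shows "\<exists>a \<in> gen_grp (set As).
    represents B B (foldl (\<lambda>M g. mat_mult M (gs ! g)) (id_rows (length B)) w) a"
  using assms
proof (induction w rule: rev_induct)
  case (snoc g w)
  have "As ! g \<in> set As" "represents B B (gs ! g) (As ! g)"
    using gens snoc.prems by (auto simp: list_all2_conv_all_nth)
  then show ?case
    using snoc by (auto intro: gen_mul represents_mult)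
qed (use id_rows gen_one in auto)

lemma word_eq:
  assumes "list_all (\<lambda>g. g < length gs) w"
    and "represents B B (foldl (\<lambda>M g. mat_mult M (gs ! g)) (id_rows (length B)) w) a"
  shows "a \<in> gen_grp (set As)"
  using word_realized[OF assms(1)] represents_unique[OF assms(2)] by blast

end

section \<open>The two coordinate spaces\<close>

lemma exhaust_7: "x = 1 \<or> x = 2 \<or> x = 3 \<or> x = 4 \<or> x = 5 \<or> x = 6 \<or> x = 7" for x :: 7
proof (induct x)
  case (of_int z)
  then have "0 \<le> z" "z < 7" by simp_all
  then have "z = 0 \<or> z = 1 \<or> z = 2 \<or> z = 3 \<or> z = 4 \<or> z = 5 \<or> z = 6" by arith
  then show ?case by auto
qed

lemma exhaust_8: "x = 1 \<or> x = 2 \<or> x = 3 \<or> x = 4 \<or> x = 5 \<or> x = 6 \<or> x = 7 \<or> x = 8" for x :: 8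
proof (induct x)
  case (of_int z)
  then have "0 \<le> z" "z < 8" by simp_all
  then have "z = 0 \<or> z = 1 \<or> z = 2 \<or> z = 3 \<or> z = 4 \<or> z = 5 \<or> z = 6 \<or> z = 7" by arith
  then show ?case by auto
qed

lemma forall_7: "(\<forall>i::7. P i) \<longleftrightarrow> P 1 \<and> P 2 \<and> P 3 \<and> P 4 \<and> P 5 \<and> P 6 \<and> P 7"
  by (metis exhaust_7)

lemma forall_8: "(\<forall>i::8. P i) \<longleftrightarrow> P 1 \<and> P 2 \<and> P 3 \<and> P 4 \<and> P 5 \<and> P 6 \<and> P 7 \<and> P 8"
  by (metis exhaust_8)

lemma UNIV_7: "UNIV = {1, 2, 3, 4, 5, 6, 7 :: 7}"
  using exhaust_7 by auto

lemma UNIV_8: "UNIV = {1, 2, 3, 4, 5, 6, 7, 8 :: 8}"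
  using exhaust_8 by auto

lemma sum_7: "sum f (UNIV :: 7 set) = f 1 + f 2 + f 3 + f 4 + f 5 + f 6 + f 7"
  unfolding UNIV_7 by (simp add: ac_simps)

lemma sum_8: "sum f (UNIV :: 8 set) = f 1 + f 2 + f 3 + f 4 + f 5 + f 6 + f 7 + f 8"
  unfolding UNIV_8 by (simp add: ac_simps)

lemma vector_7:
  "(vector [a, b, c, d, e, f, g] :: 'a::zero^7) $ 1 = a"
  "(vector [a, b, c, d, e, f, g] :: 'a::zero^7) $ 2 = b"
  "(vector [a, b, c, d, e, f, g] :: 'a::zero^7) $ 3 = c"
  "(vector [a, b, c, d, e, f, g] :: 'a::zero^7) $ 4 = d"
  "(vector [a, b, c, d, e, f, g] :: 'a::zero^7) $ 5 = e"
  "(vector [a, b, c, d, e, f, g] :: 'a::zero^7) $ 6 = f"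
  "(vector [a, b, c, d, e, f, g] :: 'a::zero^7) $ 7 = g"
  by (simp_all add: vector_def)

lemma vector_8:
  "(vector [a, b, c, d, e, f, g, h] :: 'a::zero^8) $ 1 = a"
  "(vector [a, b, c, d, e, f, g, h] :: 'a::zero^8) $ 2 = b"
  "(vector [a, b, c, d, e, f, g, h] :: 'a::zero^8) $ 3 = c"
  "(vector [a, b, c, d, e, f, g, h] :: 'a::zero^8) $ 4 = d"
  "(vector [a, b, c, d, e, f, g, h] :: 'a::zero^8) $ 5 = e"
  "(vector [a, b, c, d, e, f, g, h] :: 'a::zero^8) $ 6 = f"
  "(vector [a, b, c, d, e, f, g, h] :: 'a::zero^8) $ 7 = g"
  "(vector [a, b, c, d, e, f, g, h] :: 'a::zero^8) $ 8 = h"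
  by (simp_all add: vector_def)

section \<open>Functionals on the two affine spaces and bases of rows\<close>

definition app :: "complex^'n \<Rightarrow> complex^'n \<Rightarrow> complex" where
  "app r w = (\<Sum>i\<in>UNIV. r $ i * w $ i)"

definition kap8 :: "complex^8" where
  "kap8 = vector [-3/2, 1/2, 1/2, 1/2, 1/2, 1/2, 1/2, 1/2]"

definition xrow :: "nat \<Rightarrow> complex^8" where
  "xrow k = unitv (if k = 0 then 2 else if k = 1 then 8 else if k = 2 then 7 else if k = 3 then 6
     else if k = 4 then 5 else if k = 5 then 4 else if k = 6 then 3 else 1)"

text \<open>
  \<open>kap8\<close> and \<open>kap7\<close> are the linear functionals that equal 1 on \<open>W\<close> and \<open>V\<close>; they homogenize the affine
  functions of the paper. In \<open>basis8\<close> the matrix \<open>Xm\<close> becomes integral, and in \<open>basis7\<close> the group \<open>H1\<close>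
  acts by signed permutations of \<open>eps 1, \<dots>, eps 6\<close>: the first coordinate labelled by the sign string
  \<open>s\<close> is half of \<open>kap7 + \<Sum>p. s\<^sub>p eps p\<close>.
\<close>
definition basis8 :: "(complex^8) list" where
  "basis8 = [kap8, xrow 1, xrow 2, xrow 3, xrow 4, xrow 5, xrow 6, xrow 7]"

definition kap7 :: "complex^7" where
  "kap7 = vector [-1, -1, -1, -1, 1, 1, 1]"

definition eps :: "nat \<Rightarrow> complex^7" where
  "eps p = [vector [1/2, 1/2, -1/2, -1/2, 0, 0, 0], vector [1/2, -1/2, 1/2, -1/2, 0, 0, 0],
     vector [1/2, -1/2, -1/2, 1/2, 0, 0, 0], vector [1/2, 1/2, 1/2, 1/2, -1, 0, 0],
     vector [1/2, 1/2, 1/2, 1/2, 0, -1, 0], vector [1/2, 1/2, 1/2, 1/2, 0, 0, -1]] ! (p - 1)"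

definition basis7 :: "(complex^7) list" where
  "basis7 = [kap7, eps 1, eps 2, eps 3, eps 4, eps 5, eps 6]"

definition swap_rows :: "nat \<Rightarrow> nat \<Rightarrow> nat \<Rightarrow> int list list" where
  "swap_rows n i j = (id_rows n)[i := id_rows n ! j, j := id_rows n ! i]"

section \<open>Generators and Schreier trees\<close>

definition gensH :: "(complex^8^8) list" where
  "gensH = [s1, s2, s3, s4, s5, s6, s3']"

text \<open>The first row of each matrix is the first unit row because the generators preserve
  \<open>W\<close>, hence fix \<open>kap8\<close>. As \<open>xrow 1\<close> to \<open>xrow 6\<close>
  number the coordinates backwards, \<open>tr 3 4\<close> swaps positions 5 and 6.\<close>

definition rowsH :: "int list list list" where
  "rowsH = [
    [[1, 0, 0, 0, 0, 0, 0, 0],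
     [0, 1, 0, 0, 0, 0, 1, -1],
     [0, 0, 1, 0, 0, 0, 1, -1],
     [0, 0, 0, 1, 0, 0, 1, -1],
     [0, 0, 0, 0, 1, 0, 1, -1],
     [0, 0, 0, 0, 0, 1, 1, -1],
     [0, 0, 0, 0, 0, 0, 1, 0],
     [0, 0, 0, 0, 0, 0, 2, -1]],
    swap_rows 8 5 6, swap_rows 8 4 5, swap_rows 8 3 4, swap_rows 8 2 3, swap_rows 8 1 2,
    [[1, 0, 0, 0, 0, 0, 0, 0],
     [0, 1, 0, 0, 0, 0, 0, 0],
     [0, 0, 1, 0, 0, 0, 0, 0],
     [0, 0, 0, 1, 0, 0, 0, 0],
     [1, 0, 0, 0, 0, -1, -1, 1],
     [1, 0, 0, 0, -1, 0, -1, 1],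
     [1, 0, 0, 0, -1, -1, 0, 1],
     [1, 0, 0, 0, -1, -1, -1, 2]]]"

text \<open>The 55 edges of a spanning tree on the 56 cosets, rooted at \<open>GG\<close>. The tree
  is only a certificate: closure and distinctness of rows are evaluated afterwards.\<close>

definition treeH :: "(nat \<times> nat) list" where
  "treeH = [(0, 0), (1, 1), (2, 2), (3, 3), (4, 4), (4, 6), (5, 5), (5, 6), (7, 6), (8, 3), (9,
    3), (10, 2), (11, 2), (11, 4), (12, 1), (13, 1), (13, 4), (15, 0), (16, 0), (16, 4),
    (17, 3), (19, 4), (20, 3), (21, 6), (22, 3), (23, 2), (23, 6), (25, 2), (25, 6), (26,
    6), (28, 1), (28, 6), (30, 3), (31, 6), (32, 3), (33, 4), (34, 3), (35, 4), (36, 5),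
    (37, 2), (37, 4), (38, 5), (40, 4), (41, 5), (43, 3), (43, 5), (45, 5), (45, 6), (47,
    4), (47, 6), (49, 6), (51, 3), (52, 2), (53, 1), (54, 0)]"

definition repsH :: "int list list list" where
  "repsH = transversal rowsH [id_rows 8] treeH"

definition gensJ :: "(complex^7^7) list" where
  "gensJ = [a1', a1, a2, a3, a4, a5]"

text \<open>The reflection in \<open>eps 1 + eps 2\<close>. It brings in the even sign changes that
  enlarge the symmetric group on \<open>eps 1\<close> to \<open>eps 6\<close> to the group of type
  D6.\<close>

definition neg_swap :: "int list list" where
  "neg_swap = (id_rows 7)[1 := [0, 0, -1, 0, 0, 0, 0], 2 := [0, -1, 0, 0, 0, 0, 0]]"

definition rowsJ :: "int list list list" where
  "rowsJ = [neg_swap, swap_rows 7 1 2, swap_rows 7 2 3, swap_rows 7 3 4, swap_rows 7 4 5,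
     swap_rows 7 5 6]"

definition treeJ :: "(nat \<times> nat) list" where
  "treeJ = [(0, 0), (1, 2), (2, 1), (2, 3), (3, 3), (4, 4), (5, 2), (5, 4), (6, 5), (7, 4), (7,
    0), (8, 5), (10, 3), (10, 5), (10, 0), (13, 5), (13, 0), (14, 0), (16, 4), (16, 0),
    (17, 2), (19, 0), (20, 2), (21, 1), (22, 2), (23, 1), (25, 1), (25, 3), (27, 3), (29,
    2), (30, 0)]"

definition repsJ :: "int list list list" where
  "repsJ = transversal rowsJ [id_rows 7] treeJ"

text \<open>
  \<open>GL\<close> is a standard parabolic subgroup for the Coxeter generators of \<open>H1\<close> conjugated by \<open>(57)\<close>,
  not for the original ones.
\<close>
definition X1' :: "complex^7^7" where
  "X1' = tr 5 7 ** X1 ** tr 5 7"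

definition gensL :: "(complex^7^7) list" where
  "gensL = [a4, a1, a2, X1', a5, a1']"

definition rowsL :: "int list list list" where
  "rowsL = [swap_rows 7 4 5, swap_rows 7 1 2, swap_rows 7 2 3, swap_rows 7 3 6, swap_rows 7 5 6,
     neg_swap]"

definition treeL :: "(nat \<times> nat) list" where
  "treeL = [(0, 0), (1, 4), (2, 3), (3, 2), (4, 1), (4, 5), (5, 5), (7, 2), (8, 3), (9, 4), (10,
    0)]"

definition repsL :: "int list list list" where
  "repsL = transversal rowsL [id_rows 7] treeL"


lemma app_vector_matrix_mult: "app (r v* a) w = app r (a *v w)"
proof -
  have "app (r v* a) w = (\<Sum>i\<in>UNIV. \<Sum>j\<in>UNIV. r $ j * a $ j $ i * w $ i)"
    by (simp add: app_def vector_matrix_mult_def sum_distrib_right)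
  also have "\<dots> = (\<Sum>j\<in>UNIV. \<Sum>i\<in>UNIV. r $ j * a $ j $ i * w $ i)"
    by (rule sum.swap)
  also have "\<dots> = app r (a *v w)"
    by (simp add: app_def matrix_vector_mult_def sum_distrib_left mult.assoc)
  finally show ?thesis .
qed

lemma app_unitv: "app (unitv i) w = w $ i"
  by (simp add: app_def unitv_def if_distrib if_distribR cong: if_cong)

lemma unitv_vector_matrix_mult: "unitv i v* a = a $ i"
  by (simp add: vec_eq_iff vector_matrix_mult_def unitv_def if_distrib if_distribR cong: if_cong)

lemma vector_matrix_mult_tr: "v v* tr i j = (\<chi> c. v $ Transposition.transpose i j c)"
proof -
  have "v $ r * tr i j $ r $ c = (if r = Transposition.transpose i j c then v $ r else 0)" for r c
    by (auto simp: tr_def)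
  then show ?thesis
    by (simp add: vec_eq_iff vector_matrix_mult_def)
qed

section \<open>Integer matrices of the generators\<close>

lemma id_rows_8: "id_rows 8 = [[1, 0, 0, 0, 0, 0, 0, 0], [0, 1, 0, 0, 0, 0, 0, 0],
  [0, 0, 1, 0, 0, 0, 0, 0], [0, 0, 0, 1, 0, 0, 0, 0], [0, 0, 0, 0, 1, 0, 0, 0],
  [0, 0, 0, 0, 0, 1, 0, 0], [0, 0, 0, 0, 0, 0, 1, 0], [0, 0, 0, 0, 0, 0, 0, 1]]"
  by code_simp

lemma id_rows_7: "id_rows 7 = [[1, 0, 0, 0, 0, 0, 0], [0, 1, 0, 0, 0, 0, 0],
  [0, 0, 1, 0, 0, 0, 0], [0, 0, 0, 1, 0, 0, 0], [0, 0, 0, 0, 1, 0, 0],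
  [0, 0, 0, 0, 0, 1, 0], [0, 0, 0, 0, 0, 0, 1]]"
  by code_simp

lemma length_basis: "length basis8 = 8" "length basis7 = 7"
  by (simp_all add: basis8_def basis7_def)

lemmas basis8_defs = basis8_def kap8_def xrow_def unitv_def
lemmas basis7_defs = basis7_def kap7_def eps_def
lemmas rep8_simps = represents_def swap_rows_def id_rows_8 basis8_defs vec_eq_iff
  forall_8 vector_8
lemmas rep7_simps = represents_def swap_rows_def id_rows_7 basis7_defs vec_eq_iff
  forall_7 vector_7

lemma represents_id: "represents basis8 basis8 (id_rows 8) (mat 1)"
  "represents basis7 basis7 (id_rows 7) (mat 1)"
  by (simp add: rep8_simps) (simp add: rep7_simps)

text \<open>In the last item \<open>tr 2 3\<close> exchanges x_6 with x_0, which is not in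
  \<open>basis8\<close>; the new row is the expansion of x_0 through \<open>kap8\<close>.\<close>

lemma represents_tr8:
  "represents basis8 basis8 (swap_rows 8 5 6) (tr 3 4)"
  "represents basis8 basis8 (swap_rows 8 4 5) (tr 4 5)"
  "represents basis8 basis8 (swap_rows 8 3 4) (tr 5 6)"
  "represents basis8 basis8 (swap_rows 8 2 3) (tr 6 7)"
  "represents basis8 basis8 (swap_rows 8 1 2) (tr 7 8)"
  "represents basis8 basis8 ((id_rows 8)[6 := [2, -1, -1, -1, -1, -1, -1, 3]]) (tr 2 3)"
  by (simp_all add: rep8_simps vector_matrix_mult_tr Transposition.transpose_def)

lemma represents_s3': "represents basis8 basis8 (rowsH ! 6) s3'"
  by (simp add: rep8_simps rowsH_def s3'_def Xm_def vector_matrix_mult_def sum_8)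

lemma represents_s1: "represents basis8 basis8 (rowsH ! 0) s1"
  by (simp add: rep8_simps rowsH_def s1_def vector_matrix_mul_assoc[symmetric]
      vector_matrix_mult_tr Transposition.transpose_def)
    (simp add: Ym_def unitv_def vector_matrix_mult_def sum_8 vector_8)

lemma represents_tr7:
  "represents basis7 basis7 (swap_rows 7 1 2) (tr 2 3)"
  "represents basis7 basis7 (swap_rows 7 2 3) (tr 3 4)"
  "represents basis7 basis7 (swap_rows 7 4 5) (tr 5 6)"
  "represents basis7 basis7 (swap_rows 7 5 6) (tr 6 7)"
  "represents basis7 basis7 (swap_rows 7 4 6) (tr 5 7)"
  "represents basis7 basis7 neg_swap (tr 1 4)"
  by (simp_all add: rep7_simps neg_swap_def vector_matrix_mult_tr Transposition.transpose_def)

lemma represents_X1: "represents basis7 basis7 (swap_rows 7 3 4) X1"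
  by (simp add: rep7_simps X1_def unitv_def vector_matrix_mult_def sum_7)

text \<open>\<open>basis8\<close> contains every unit row except the second, which
  \<open>kap8\<close> supplies through its nonzero second entry.\<close>

lemma separating8:
  assumes "\<And>b. b \<in> set basis8 \<Longrightarrow> b v* A = b v* A'"
  shows "A = (A' :: complex^'n^8)"
proof -
  have unit: "A $ i = A' $ i" if "unitv i \<in> set basis8" for i
    using assms[OF that] by (simp add: unitv_vector_matrix_mult)
  have e: "A $ 1 = A' $ 1" "A $ 3 = A' $ 3" "A $ 4 = A' $ 4" "A $ 5 = A' $ 5" "A $ 6 = A' $ 6"
    "A $ 7 = A' $ 7" "A $ 8 = A' $ 8"
    by (rule unit, simp add: basis8_def xrow_def)+
  have "kap8 v* A = kap8 v* A'"
    by (rule assms) (simp add: basis8_def)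
  then have "A $ 2 = A' $ 2"
    using e by (simp add: vec_eq_iff vector_matrix_mult_def sum_8 kap8_def vector_8)
  then show ?thesis
    using e by (simp add: vec_eq_iff[of A A'] forall_8)
qed

text \<open>Some unit rows have half-integral coordinates in \<open>basis7\<close>; doubling makes
  integer lists suffice.\<close>

lemma unitv_eq_lin_comb7:
  "2 *s unitv 1 = lin_comb basis7 [1, 1, 1, 1, 1, 1, 1]"
  "2 *s unitv 2 = lin_comb basis7 [1, 1, -1, -1, 1, 1, 1]"
  "2 *s unitv 3 = lin_comb basis7 [1, -1, 1, -1, 1, 1, 1]"
  "2 *s unitv 4 = lin_comb basis7 [1, -1, -1, 1, 1, 1, 1]"
  "2 *s unitv 5 = lin_comb basis7 [2, 0, 0, 0, 0, 2, 2]"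
  "2 *s unitv 6 = lin_comb basis7 [2, 0, 0, 0, 2, 0, 2]"
  "2 *s unitv 7 = lin_comb basis7 [2, 0, 0, 0, 2, 2, 0]"
  by (simp_all add: basis7_defs unitv_def vec_eq_iff forall_7 vector_7)

lemma lin_comb_cong_mult:
  assumes "\<And>b. b \<in> set B \<Longrightarrow> b v* A = b v* A'"
  shows "lin_comb B c v* A = lin_comb B c v* (A' :: complex^'m^'n)"
  using assms
  by (induction B c rule: lin_comb.induct)
    (auto simp: vector_matrix_left_distrib scalar_vector_matrix_assoc)

lemma separating7:
  assumes "\<And>b. b \<in> set basis7 \<Longrightarrow> b v* A = b v* A'"
  shows "A = (A' :: complex^'n^7)"
proof -
  have "A $ i = A' $ i" if "2 *s unitv i = lin_comb basis7 c" for i c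
  proof -
    have "(2 *s unitv i) v* A = (2 *s unitv i) v* A'"
      unfolding that by (rule lin_comb_cong_mult) (rule assms)
    then show ?thesis
      by (simp add: scalar_vector_matrix_assoc unitv_vector_matrix_mult)
  qed
  then show ?thesis
    using unitv_eq_lin_comb7 by (auto simp: vec_eq_iff[of A A'] forall_7)
qed

lemma independent8: "inj_on (lin_comb basis8) {xs. length xs = 8}"
proof (rule inj_onI, clarify)
  fix x y :: "int list"
  assume "length x = 8" "length y = 8" and eq: "lin_comb basis8 x = lin_comb basis8 y"
  then obtain a b c d e f g h a' b' c' d' e' f' g' h'
    where xy: "x = [a, b, c, d, e, f, g, h]" "y = [a', b', c', d', e', f', g', h']"
    by (auto simp: length_Suc_conv eval_nat_numeral)
  have "Re (lin_comb basis8 x $ i) = Re (lin_comb basis8 y $ i)" for i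
    using eq by simp
  from this[of 1] this[of 2] this[of 3] this[of 4] this[of 5] this[of 6] this[of 7] this[of 8]
  have "real_of_int a = a'" "real_of_int b = b'" "real_of_int c = c'" "real_of_int d = d'"
    "real_of_int e = e'" "real_of_int f = f'" "real_of_int g = g'" "real_of_int h = h'"
    by (simp_all add: xy basis8_defs vector_8)
  then show "x = y"
    by (simp add: xy)
qed

lemma independent7: "inj_on (lin_comb basis7) {xs. length xs = 7}"
proof (rule inj_onI, clarify)
  fix x y :: "int list"
  assume "length x = 7" "length y = 7" and eq: "lin_comb basis7 x = lin_comb basis7 y"
  then obtain a b c d e f g a' b' c' d' e' f' g'
    where xy: "x = [a, b, c, d, e, f, g]" "y = [a', b', c', d', e', f', g']"
    by (auto simp: length_Suc_conv eval_nat_numeral)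
  have "Re (lin_comb basis7 x $ i) = Re (lin_comb basis7 y $ i)" for i
    using eq by simp
  from this[of 1] this[of 2] this[of 3] this[of 4] this[of 5] this[of 6] this[of 7]
  have "real_of_int a = a'" "real_of_int b = b'" "real_of_int c = c'" "real_of_int d = d'"
    "real_of_int e = e'" "real_of_int f = f'" "real_of_int g = g'"
    by (simp_all add: xy basis7_defs vector_7)
  then show "x = y"
    by (simp add: xy)
qed

lemma gensH_represented: "list_all2 (represents basis8 basis8) rowsH gensH"
  using represents_s1 represents_s3' represents_tr8
  by (simp add: gensH_def rowsH_def s2_def s3_def s4_def s5_def s6_def)

lemma represents_X1': "represents basis7 basis7 (swap_rows 7 3 6) X1'"
proof -
  have "mat_mult (mat_mult (swap_rows 7 4 6) (swap_rows 7 3 4)) (swap_rows 7 4 6) = swap_rows 7 3 6"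
    by code_simp
  then show ?thesis
    using represents_mult[OF represents_mult[OF represents_tr7(5) represents_X1] represents_tr7(5)]
    by (simp add: X1'_def)
qed

lemma gensJ_represented: "list_all2 (represents basis7 basis7) rowsJ gensJ"
  using represents_tr7 represents_X1
  by (simp add: gensJ_def rowsJ_def a1_def a2_def a3_def a4_def a5_def a1'_def)

lemma gensL_represented: "list_all2 (represents basis7 basis7) rowsL gensL"
  using represents_tr7 represents_X1'
  by (simp add: gensL_def rowsL_def a1_def a2_def a4_def a5_def a1'_def)

text \<open>The rows fixed by the three subgroups, in coordinates: \<open>unitv 2\<close>, twice
  \<open>unitv 1\<close>, and \<open>kap7\<close> plus twice \<open>eps 4\<close>, which is F + G -
  E.\<close>

definition fH :: "int list" where "fH = [2, -1, -1, -1, -1, -1, -1, 3]"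
definition fJ :: "int list" where "fJ = [1, 1, 1, 1, 1, 1, 1]"
definition fL :: "int list" where "fL = [1, 0, 0, 0, 2, 0, 0]"

section \<open>The three Schreier models: E6 in E7, A5 in D6, D5 in D6\<close>

interpretation H: schreier_model basis8 gensH rowsH fH treeH repsH
proof
  show "repsH = transversal rowsH [id_rows (length basis8)] treeH"
    by (simp add: repsH_def length_basis)
  show "list_all (\<lambda>g. mat_mult g g = id_rows (length basis8)) rowsH"
    unfolding length_basis by code_simp
  show "schreier_closed rowsH repsH"
    by code_simp
  show "distinct (map (row_mult fH) repsH)"
    by code_simp
  show "list_all (\<lambda>M. length (row_mult fH M) = length basis8) repsH"
    unfolding length_basis by code_simp
  show "list_all (\<lambda>g. row_mult fH g = fH) (tl rowsH)"
    by code_simp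
qed (use gensH_represented separating8 independent8 represents_id length_basis in auto)

interpretation J: schreier_model basis7 gensJ rowsJ fJ treeJ repsJ
proof
  show "repsJ = transversal rowsJ [id_rows (length basis7)] treeJ"
    by (simp add: repsJ_def length_basis)
  show "list_all (\<lambda>g. mat_mult g g = id_rows (length basis7)) rowsJ"
    unfolding length_basis by code_simp
  show "schreier_closed rowsJ repsJ"
    by code_simp
  show "distinct (map (row_mult fJ) repsJ)"
    by code_simp
  show "list_all (\<lambda>M. length (row_mult fJ M) = length basis7) repsJ"
    unfolding length_basis by code_simp
  show "list_all (\<lambda>g. row_mult fJ g = fJ) (tl rowsJ)"
    by code_simp
qed (use gensJ_represented separating7 independent7 represents_id length_basis in auto)

interpretation L: schreier_model basis7 gensL rowsL fL treeL repsL
proof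
  show "repsL = transversal rowsL [id_rows (length basis7)] treeL"
    by (simp add: repsL_def length_basis)
  show "list_all (\<lambda>g. mat_mult g g = id_rows (length basis7)) rowsL"
    unfolding length_basis by code_simp
  show "schreier_closed rowsL repsL"
    by code_simp
  show "distinct (map (row_mult fL) repsL)"
    by code_simp
  show "list_all (\<lambda>M. length (row_mult fL M) = length basis7) repsL"
    unfolding length_basis by code_simp
  show "list_all (\<lambda>g. row_mult fL g = fL) (tl rowsL)"
    by code_simp
qed (use gensL_represented separating7 independent7 represents_id length_basis in auto)

section \<open>Generators and the isomorphism\<close>

lemma tr_tr [simp]: "tr i j ** tr i j = mat 1"
proof -
  have "v v* (tr i j ** tr i j) = v" for v
    by (simp add: vector_matrix_mul_assoc[symmetric] vector_matrix_mult_tr vec_eq_iff)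
  then show ?thesis
    by (metis unitv_vector_matrix_mult vec_eq_iff vector_matrix_mul_rid)
qed

lemma tr_conj_mem:
  assumes "tr i j \<in> gen_grp S" "tr j k \<in> gen_grp S" "i \<noteq> j" "j \<noteq> k" "i \<noteq> k"
  shows "tr i k \<in> gen_grp S"
proof -
  have "v v* tr i k = v v* (tr i j ** tr j k ** tr i j)" for v
    using assms(3-)
    by (auto simp: vector_matrix_mul_assoc[symmetric] vector_matrix_mult_tr vec_eq_iff
        Transposition.transpose_def)
  then have "tr i k = tr i j ** tr j k ** tr i j"
    by (metis unitv_vector_matrix_mult vec_eq_iff)
  then show ?thesis
    using assms by (simp add: gen_grp_mult)
qed

lemma tr_commute: "tr i j = tr j i"
  by (simp add: tr_def transpose_commute)

text \<open>The Coxeter generators contain only the product \<open>s1 = Ym ** tr 2 3\<close>, so the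
  two defining generators of \<open>HH\<close> have to be recovered separately.\<close>

lemma tr_2_3_mem: "tr 2 3 \<in> gen_grp (set gensH)"
proof (rule H.word_eq)
  \<comment> \<open>The word is a palindrome about \<open>s1\<close>: it exhibits the reflection
    \<open>tr 2 3\<close> as a conjugate of \<open>s1\<close>.\<close>
  let ?w = "[6, 3, 4, 2, 3, 6, 5, 4, 3, 2, 1, 0, 1, 2, 3, 4, 5, 6, 3, 2, 4, 3, 6] :: nat list"
  show "list_all (\<lambda>g. g < length rowsH) ?w"
    by code_simp
  have "foldl (\<lambda>M g. mat_mult M (rowsH ! g)) (id_rows 8) ?w =
      (id_rows 8)[6 := [2, -1, -1, -1, -1, -1, -1, 3]]"
    by code_simp
  then show "represents basis8 basis8
      (foldl (\<lambda>M g. mat_mult M (rowsH ! g)) (id_rows (length basis8)) ?w) (tr 2 3)"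
    using represents_tr8(6) by (simp only: length_basis)
qed

lemma HH_eq: "HH = gen_grp (set gensH)"
  unfolding HH_def
proof (rule gen_grp_eqI)
  have "Ym = s1 ** tr 2 3"
    by (simp add: s1_def matrix_mul_assoc[symmetric])
  then have "Ym \<in> gen_grp (set gensH)"
    using gen_grp_mult[OF gen_grp_incl tr_2_3_mem, of s1] by (simp add: gensH_def)
  then show "{tr 2 3, tr 3 4, tr 4 5, tr 5 6, tr 6 7, tr 7 8, Xm, Ym} \<subseteq> gen_grp (set gensH)"
    using tr_2_3_mem
    by (auto simp: gensH_def s2_def s3_def s4_def s5_def s6_def s3'_def intro: gen_grp_incl)
  show "set gensH \<subseteq> gen_grp {tr 2 3, tr 3 4, tr 4 5, tr 5 6, tr 6 7, tr 7 8, Xm, Ym}"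
    by (auto simp: gensH_def s1_def s2_def s3_def s4_def s5_def s6_def s3'_def
        intro: gen_grp_mult gen_grp_incl)
qed (rule H.involutive)

lemma GG_eq: "GG = gen_grp (set (tl gensH))"
  by (simp add: GG_def gensH_def)

lemma GJ_eq: "GJ = gen_grp (set (tl gensJ))"
  by (simp add: GJ_def gensJ_def a1_def a2_def a3_def a4_def a5_def insert_commute)

text \<open>Only \<open>tr 1 2\<close> and \<open>tr 1 4\<close> distinguish the two generating
  sets; each is reached from the other through \<open>tr 1 3\<close>, with the help of
  \<open>tr 2 3\<close> and \<open>tr 3 4\<close>.\<close>

lemma H1_eq_gensJ: "H1 = gen_grp (set gensJ)"
  unfolding H1_def
proof (rule gen_grp_eqI)
  let ?G = "{tr 1 2, tr 2 3, tr 3 4, tr 5 6, tr 6 7, X1} :: (complex^7^7) set"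
  have "tr 1 3 \<in> gen_grp (set gensJ)"
    by (rule tr_conj_mem[of 1 4])
      (auto simp: gensJ_def a1'_def a2_def tr_commute[of 4 3] intro: gen_grp_incl)
  then have "tr 1 2 \<in> gen_grp (set gensJ)"
    by (rule tr_conj_mem[of 1 3])
      (auto simp: gensJ_def a1_def tr_commute[of 3 2] intro: gen_grp_incl)
  then show "?G \<subseteq> gen_grp (set gensJ)"
    by (auto simp: gensJ_def a1_def a2_def a3_def a4_def a5_def intro: gen_grp_incl)
  have "tr 1 3 \<in> gen_grp ?G"
    by (rule tr_conj_mem[of 1 2]) (auto intro: gen_grp_incl)
  then have "tr 1 4 \<in> gen_grp ?G"
    by (rule tr_conj_mem[of 1 3]) (auto intro: gen_grp_incl)
  then show "set gensJ \<subseteq> gen_grp ?G"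
    by (auto simp: gensJ_def a1_def a2_def a3_def a4_def a5_def a1'_def intro: gen_grp_incl)
qed (rule J.involutive)

text \<open>\<open>tr 5 7\<close> lies in both generated groups, and conjugation by it exchanges
  \<open>X1\<close> and \<open>X1'\<close>.\<close>

lemma H1_eq_gensL: "H1 = gen_grp (set gensL)"
  unfolding H1_eq_gensJ
proof (rule gen_grp_eqI)
  have 57: "tr 5 7 \<in> gen_grp (set gensL)" "tr 5 7 \<in> gen_grp (set gensJ)"
    by (rule tr_conj_mem[of 5 6];
        auto simp: gensL_def gensJ_def a4_def a5_def intro: gen_grp_incl)+
  have "X1 = tr 5 7 ** X1' ** tr 5 7"
  proof -
    have "tr 5 7 ** X1' ** tr 5 7 = (tr 5 7 ** tr 5 7) ** X1 ** (tr 5 7 ** tr 5 7)"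
      unfolding X1'_def by (simp only: matrix_mul_assoc)
    then show ?thesis
      by simp
  qed
  then have "a3 \<in> gen_grp (set gensL)"
    using 57(1) gen_grp_incl[of X1' "set gensL"]
    by (metis a3_def gen_grp_mult gensL_def list.set_intros)
  then show "set gensJ \<subseteq> gen_grp (set gensL)"
    by (auto simp: gensL_def gensJ_def intro: gen_grp_incl)
  have "X1' \<in> gen_grp (set gensJ)"
    using 57 by (auto simp: X1'_def a3_def gensJ_def intro: gen_grp_mult gen_grp_incl)
  then show "set gensL \<subseteq> gen_grp (set gensJ)"
    by (auto simp: gensL_def gensJ_def intro: gen_grp_incl)
qed (rule L.involutive)

lemma GL_eq: "GL = gen_grp (set (tl gensL))"
  unfolding GL_def
proof (rule gen_grp_eqI)
  let ?G = "{tr 1 2, tr 2 3, tr 3 4, tr 6 7, tr 5 7 ** X1 ** tr 5 7} :: (complex^7^7) set"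
  have "tr 1 3 \<in> gen_grp (set (tl gensL))"
    by (rule tr_conj_mem[of 1 4])
      (auto simp: gensL_def a1'_def a2_def tr_commute[of 4 3] intro: gen_grp_incl)
  then have "tr 1 2 \<in> gen_grp (set (tl gensL))"
    by (rule tr_conj_mem[of 1 3])
      (auto simp: gensL_def a1_def tr_commute[of 3 2] intro: gen_grp_incl)
  then show "?G \<subseteq> gen_grp (set (tl gensL))"
    by (auto simp: gensL_def a1_def a2_def a5_def X1'_def intro: gen_grp_incl)
  have "tr 1 3 \<in> gen_grp ?G"
    by (rule tr_conj_mem[of 1 2]) (auto intro: gen_grp_incl)
  then have "tr 1 4 \<in> gen_grp ?G"
    by (rule tr_conj_mem[of 1 3]) (auto intro: gen_grp_incl)
  then show "set (tl gensL) \<subseteq> gen_grp ?G"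
    by (auto simp: gensL_def a1_def a2_def a5_def a1'_def X1'_def intro: gen_grp_incl)
qed (rule L.involutive_T)

section \<open>The intertwiner between the two groups\<close>

text \<open>
  \<open>down\<close> sends \<open>kap8\<close> to \<open>2 kap7\<close> and the row of a \<open>J\<close> or \<open>L\<close> coset to its image under \<open>\<gamma>\<^sub>1\<close>; its kernel
  is spanned by \<open>x\<^sub>0 - x\<^sub>1\<close>, which \<open>Q\<close> fixes, and \<open>color_mat / 4\<close> is the projection onto that kernel.
\<close>
definition down :: "complex^7^8" where
  "down = vector [vector [-2, 0, 0, 0, 2, 2, -2], vector [0, 0, 0, 0, 1, 1, -1],
     vector [-2, 0, 0, 0, 2, 0, 0], vector [-2, 0, 0, 0, 0, 2, 0], vector [-2, -2, -2, 0, 2, 2, 0],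
     vector [-2, -2, 0, -2, 2, 2, 0], vector [-2, 0, -2, -2, 2, 2, 0], vector [0, 0, 0, 0, 1, 1, -1]]"

text \<open>Scaled by 4 to have integer entries; it inverts \<open>down\<close> up to the projection
  onto the kernel, as \<open>up_down\<close> and \<open>down_up\<close> record.\<close>

definition up :: "complex^8^7" where
  "up = vector [vector [-2, 2, 0, 0, 0, 0, 0, 2], vector [-1, 1, 1, 1, -1, -1, 1, 1],
     vector [-1, 1, 1, 1, -1, 1, -1, 1], vector [-1, 1, 1, 1, 1, -1, -1, 1],
     vector [-2, 2, 2, 0, 0, 0, 0, 2], vector [-2, 2, 0, 2, 0, 0, 0, 2],
     vector [-4, 2, 2, 2, 0, 0, 0, 2]]"

definition color_mat :: "complex^8^8" where
  "color_mat = vector [0, vector [0, 2, 0, 0, 0, 0, 0, -2], 0, 0, 0, 0, 0,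
     vector [0, -2, 0, 0, 0, 0, 0, 2]]"

definition down_rows :: "int list list" where
  "down_rows = [[2, 0, 0, 0, 0, 0, 0], [1, 0, 0, 0, 0, 0, 2], [1, 1, -1, -1, -1, -1, 1],
     [1, -1, 1, -1, -1, -1, 1], [1, -1, -1, 1, -1, -1, 1], [1, -1, -1, -1, 1, -1, 1],
     [1, -1, -1, -1, -1, 1, 1], [1, -1, -1, -1, -1, -1, 3]]"

lemma represents_down: "represents basis8 basis7 down_rows down"
  by (simp add: represents_def down_rows_def basis8_defs basis7_defs vec_eq_iff forall_7 vector_7
      vector_8 vector_matrix_mult_def sum_8 down_def)

lemma up_down: "up ** down = mat 4"
  by (simp add: vec_eq_iff matrix_matrix_mult_def forall_7 sum_8 up_def down_def vector_7 vector_8 mat_def)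

lemma down_up: "down ** up + color_mat = mat 4"
  by (simp add: vec_eq_iff matrix_matrix_mult_def forall_8 sum_7 up_def down_def vector_7 vector_8 mat_def
      color_mat_def)

text \<open>The first condition determines \<open>h\<close> from \<open>a\<close>, but it cannot see
  the part of \<open>a\<close> that lands in the kernel of \<open>down\<close>. With the second
  condition \<open>h\<close> determines \<open>a\<close> as well.\<close>

definition intertwined :: "complex^8^8 \<Rightarrow> complex^7^7 \<Rightarrow> bool" where
  "intertwined a h \<longleftrightarrow> a ** down = down ** h \<and> a ** color_mat = color_mat"

lemma intertwined_mult:
  "intertwined a h \<Longrightarrow> intertwined a' h' \<Longrightarrow> intertwined (a ** a') (h ** h')"
  unfolding intertwined_def by (metis matrix_mul_assoc)

lemma intertwined_one: "intertwined (mat 1) (mat 1)"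
  by (simp add: intertwined_def)

lemma tr_mult: "tr i j ** A = (\<chi> r. A $ Transposition.transpose i j r)"
proof -
  have "unitv r v* (tr i j ** A) = A $ Transposition.transpose i j r" for r
  proof -
    have "unitv r v* tr i j = unitv (Transposition.transpose i j r)"
      by (auto simp: vector_matrix_mult_tr unitv_def vec_eq_iff)
    then show ?thesis
      by (simp add: vector_matrix_mul_assoc[symmetric] unitv_vector_matrix_mult)
  qed
  then show ?thesis
    by (simp add: unitv_vector_matrix_mult vec_eq_iff)
qed

text \<open>The nonzero columns of \<open>color_mat\<close> are multiples of e_2 - e_8. The
  transpositions \<open>s2\<close> to \<open>s5\<close> move neither coordinate; for
  \<open>s1\<close> and \<open>s3'\<close> it is a computation.\<close>

lemma color_fixed:
  "s1 ** color_mat = color_mat" "s2 ** color_mat = color_mat" "s3 ** color_mat = color_mat"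
  "s4 ** color_mat = color_mat" "s5 ** color_mat = color_mat" "s3' ** color_mat = color_mat"
proof -
  show "s1 ** color_mat = color_mat"
    by (simp add: s1_def matrix_mul_assoc[symmetric] tr_mult)
      (simp add: Ym_def vec_eq_iff matrix_matrix_mult_def forall_8 sum_8 vector_8 color_mat_def
        Transposition.transpose_def unitv_def)
  show "s2 ** color_mat = color_mat" "s3 ** color_mat = color_mat"
    "s4 ** color_mat = color_mat" "s5 ** color_mat = color_mat"
    by (simp_all add: s2_def s3_def s4_def s5_def tr_mult vec_eq_iff forall_8 vector_8 color_mat_def
        Transposition.transpose_def)
  show "s3' ** color_mat = color_mat"
    by (simp add: s3'_def Xm_def vec_eq_iff matrix_matrix_mult_def forall_8 sum_8 vector_8
        color_mat_def unitv_def)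
qed

lemma mult_downI:
  assumes "represents basis8 basis8 M a" "represents basis7 basis7 N h"
    and "mat_mult M down_rows = mat_mult down_rows N"
  shows "a ** down = down ** h"
proof (rule separating8)
  have "map (\<lambda>b. b v* (a ** down)) basis8 = map (\<lambda>b. b v* (down ** h)) basis8"
    using represents_mult[OF assms(1) represents_down] represents_mult[OF represents_down assms(2)]
      assms(3) unfolding represents_def by simp
  then show "b v* (a ** down) = b v* (down ** h)" if "b \<in> set basis8" for b
    using that by simp
qed

lemma intertwined_gens:
  "intertwined s1 a5" "intertwined s2 a4" "intertwined s3 a3"
  "intertwined s4 a2" "intertwined s5 a1" "intertwined s3' a1'"
proof -
  have H: "represents basis8 basis8 (rowsH ! k) (gensH ! k)" if "k < 7" for k
    using that gensH_represented by (auto simp: list_all2_conv_all_nth gensH_def)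
  have J: "represents basis7 basis7 (rowsJ ! k) (gensJ ! k)" if "k < 6" for k
    using that gensJ_represented by (auto simp: list_all2_conv_all_nth gensJ_def)
  \<comment> \<open>Each pair matches the position of a generator of \<open>QQ\<close> in
    \<open>gensH\<close> with the position of its image under m in \<open>gensJ\<close>.\<close>
  have eq: "list_all (\<lambda>(k, l). mat_mult (rowsH ! k) down_rows = mat_mult down_rows (rowsJ ! l))
      [(0, 5), (1, 4), (2, 3), (3, 2), (4, 1), (6, 0)]"
    by code_simp
  show "intertwined s1 a5" "intertwined s2 a4" "intertwined s3 a3"
    "intertwined s4 a2" "intertwined s5 a1" "intertwined s3' a1'"
    using mult_downI[OF H J, of 0 5] mult_downI[OF H J, of 1 4] mult_downI[OF H J, of 2 3]
      mult_downI[OF H J, of 3 2] mult_downI[OF H J, of 4 1] mult_downI[OF H J, of 6 0]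
      eq color_fixed
    by (simp_all add: intertwined_def gensH_def gensJ_def)
qed

lemma intertwined_unique_right:
  assumes "intertwined a h" "intertwined a h'"
  shows "h = h'"
proof -
  have "up ** (down ** h) = up ** (down ** h')"
    using assms by (simp add: intertwined_def)
  then have "mat 4 ** h = mat 4 ** h'"
    by (simp add: matrix_mul_assoc up_down)
  then show ?thesis
    by (simp add: vec_eq_iff matrix_matrix_mult_def mat_def if_distrib[of "\<lambda>x. x * _"] cong: if_cong)
qed

text \<open>\<open>a ** down\<close> and \<open>a ** color_mat\<close> together determine
  \<open>a\<close>, because \<open>down ** up + color_mat\<close> is 4 times the identity.\<close>

lemma intertwined_unique_left:
  assumes "intertwined a h" "intertwined a' h"
  shows "a = a'"
proof -
  have "a ** (down ** up + color_mat) = a' ** (down ** up + color_mat)"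
    using assms by (simp add: intertwined_def matrix_add_ldistrib matrix_mul_assoc)
  then have "a ** mat 4 = a' ** mat 4"
    by (simp add: down_up)
  then show ?thesis
    by (simp add: vec_eq_iff matrix_matrix_mult_def mat_def if_distrib[of "(*) _"] cong: if_cong)
qed

text \<open>Carries a multiplicative relation from generators to words. Applied in both directions,
  it relates every element of \<open>QQ\<close> to one of \<open>H1\<close> and conversely.\<close>

lemma gen_grp_related:
  assumes "involutive S" "a \<in> gen_grp S"
    and "P (mat 1) (mat 1)" "\<And>a h a' h'. P a h \<Longrightarrow> P a' h' \<Longrightarrow> P (a ** a') (h ** h')"
    and "\<And>s. s \<in> S \<Longrightarrow> \<exists>t \<in> T. P s t"
  shows "\<exists>h \<in> gen_grp T. P a h"
  using assms(2,1)
proof (induction rule: gen_grp_involutive_induct)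
  case one
  then show ?case
    using assms(3) gen_one by blast
next
  case (mult g s)
  then show ?case
    using assms(4,5) gen_mul by meson
qed

lemma involutive_Q: "involutive {s1, s2, s3, s4, s5, s3'}"
  using H.involutive by (simp add: involutive_def gensH_def)

lemma QQ_subset_HH: "QQ \<subseteq> HH"
  unfolding QQ_def HH_eq
  by (rule gen_grp_subset) (use involutive_Q in \<open>auto simp: gensH_def intro: gen_grp_incl\<close>)

lemma QQ_intertwined: "a \<in> QQ \<Longrightarrow> \<exists>h \<in> H1. intertwined a h"
  unfolding QQ_def H1_eq_gensJ
  by (rule gen_grp_related[OF involutive_Q])
    (use intertwined_gens in \<open>auto simp: gensJ_def intro: intertwined_one intertwined_mult\<close>)

lemma H1_intertwined: "h \<in> H1 \<Longrightarrow> \<exists>a \<in> QQ. intertwined a h"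
  unfolding QQ_def H1_eq_gensJ
  by (rule gen_grp_related[OF J.involutive, where P = "\<lambda>h a. intertwined a h"])
    (use intertwined_gens in \<open>auto simp: gensJ_def intro: intertwined_one intertwined_mult\<close>)

text \<open>\<open>mm\<close> is a choice among maps with these properties, so one must exist.
  Intertwining is the graph of a bijection from \<open>QQ\<close> to \<open>H1\<close>, and its
  uniqueness makes the bijection multiplicative.\<close>

lemma mm_isomorphism:
  "bij_betw mm QQ H1 \<and> (\<forall>x\<in>QQ. \<forall>y\<in>QQ. mm (x ** y) = mm x ** mm y)
    \<and> mm s1 = a5 \<and> mm s2 = a4 \<and> mm s3 = a3 \<and> mm s4 = a2 \<and> mm s5 = a1 \<and> mm s3' = a1'"
proof -
  obtain f where f: "\<And>a. a \<in> QQ \<Longrightarrow> f a \<in> H1 \<and> intertwined a (f a)"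
    using QQ_intertwined by metis
  have eq: "f a = h" if "a \<in> QQ" "intertwined a h" for a h
    using f[OF that(1)] that(2) intertwined_unique_right by blast
  have "bij_betw f QQ H1"
  proof (rule bij_betw_imageI)
    show "inj_on f QQ"
      using f intertwined_unique_left by (metis inj_onI)
    show "f ` QQ = H1"
      using f eq H1_intertwined by (auto simp: image_iff) metis
  qed
  moreover have "f (x ** y) = f x ** f y" if "x \<in> QQ" "y \<in> QQ" for x y
    using that f by (intro eq intertwined_mult) (auto simp: QQ_def intro: gen_grp_mult)
  moreover have "f s1 = a5" "f s2 = a4" "f s3 = a3" "f s4 = a2" "f s5 = a1" "f s3' = a1'"
    using intertwined_gens by (auto intro!: eq simp: QQ_def intro: gen_grp_incl)
  ultimately have "\<exists>f. bij_betw f QQ H1 \<and> (\<forall>x\<in>QQ. \<forall>y\<in>QQ. f (x ** y) = f x ** f y)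
    \<and> f s1 = a5 \<and> f s2 = a4 \<and> f s3 = a3 \<and> f s4 = a2 \<and> f s5 = a1 \<and> f s3' = a1'"
    by blast
  from someI_ex[OF this] show ?thesis
    unfolding mm_def .
qed

lemma mm_mem: "a \<in> QQ \<Longrightarrow> mm a \<in> H1"
  using mm_isomorphism by (meson bij_betwE)

text \<open>The chosen \<open>mm\<close> is known only through multiplicativity and its values on
  generators, so intertwining is carried along words.\<close>

lemma mm_intertwined:
  assumes "a \<in> QQ"
  shows "intertwined a (mm a)"
  using assms involutive_Q unfolding QQ_def
proof (induction rule: gen_grp_involutive_induct)
  case one
  have Q: "mat 1 \<in> QQ"
    by (simp add: QQ_def gen_one)
  \<comment> \<open>The image of the identity is idempotent, hence the identity of the group
    \<open>H1\<close>.\<close>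
  then have "mm (mat 1) = mm (mat 1) ** mm (mat 1)"
    using mm_isomorphism by (metis matrix_mul_rid)
  moreover have "mm (mat 1) \<in> gen_grp (set gensJ)"
    using mm_mem[OF Q] by (simp add: H1_eq_gensJ)
  ultimately have "mm (mat 1) = mat 1"
    using gen_grp_inverse(2)[OF J.involutive] by (metis matrix_mul_assoc matrix_mul_rid)
  then show ?case
    by (simp add: intertwined_one)
next
  case (mult g s)
  then have "mm (g ** s) = mm g ** mm s" "intertwined s (mm s)"
    using mm_isomorphism intertwined_gens by (auto simp: QQ_def gen_grp_incl)
  then show ?case
    using mult by (simp add: intertwined_mult)
qed

section \<open>Coset labels\<close>

text \<open>\<open>W\<close> is an affine hyperplane missing the origin, so it spans: the points
  \<open>2 *s unitv i\<close> for i other than 1 and \<open>unitv 1 + 5 *s unitv 2\<close> already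
  do.\<close>

lemma row_eqI_W:
  assumes "\<And>w. w \<in> W \<Longrightarrow> app r w = app r' w"
  shows "r = r'"
proof -
  have "r $ i = r' $ i" if "i \<noteq> 1" for i
  proof -
    have "2 *s unitv i \<in> W"
      using that exhaust_8[of i] by (auto simp: W_def unitv_def)
    then have "app r (2 *s unitv i) = app r' (2 *s unitv i)"
      by (rule assms)
    then show ?thesis
      by (simp add: app_def unitv_def if_distrib cong: if_cong)
  qed
  moreover have "r $ 1 = r' $ 1"
  proof -
    have "unitv 1 + 5 *s unitv 2 \<in> W"
      by (simp add: W_def unitv_def)
    then have "app r (unitv 1 + 5 *s unitv 2) = app r' (unitv 1 + 5 *s unitv 2)"
      by (rule assms)
    then show ?thesis
      using calculation[of 2] by (simp add: app_def unitv_def sum_8)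
  qed
  ultimately show ?thesis
    by (metis vec_eq_iff)
qed

lemma row_eqI_V:
  assumes "\<And>x. x \<in> V \<Longrightarrow> app r x = app r' x"
  shows "r = r'"
proof -
  have e: "r $ i = r' $ i" if "i \<in> {5, 6, 7}" for i
  proof -
    have "unitv i \<in> V"
      using that by (auto simp: V_def unitv_def)
    then show ?thesis
      using assms[of "unitv i"] by (simp add: app_def unitv_def if_distrib cong: if_cong)
  qed
  have "r $ i = r' $ i" if "i \<in> {1, 2, 3, 4}" for i
  proof -
    have "unitv i + 2 *s unitv 5 \<in> V"
      using that by (auto simp: V_def unitv_def)
    then have "app r (unitv i + 2 *s unitv 5) = app r' (unitv i + 2 *s unitv 5)"
      by (rule assms)
    then show ?thesis
      using e[of 5] that by (auto simp: app_def unitv_def sum_7)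
  qed
  then show ?thesis
    using e by (simp add: vec_eq_iff forall_7)
qed

lemma app_add: "app (r + r') w = app r w + app r' w"
  by (simp add: app_def sum.distrib ring_distribs)

lemma app_diff: "app (r - r') w = app r w - app r' w"
  by (simp add: app_def sum_subtractf ring_distribs)

lemma app_scale: "app (c *s r) w = c * app r w"
  by (simp add: app_def sum_distrib_left mult.assoc)

lemma app_kap8: "w \<in> W \<Longrightarrow> app kap8 w = 1"
  by (simp add: app_def sum_8 kap8_def vector_8 W_def field_simps)

lemma app_xrow: "app (xrow k) w = xc k w"
  by (simp add: xrow_def app_unitv xc_def)

section \<open>The 56 cosets of \<open>GG\<close> in \<open>HH\<close>\<close>

definition vrow :: "nat \<Rightarrow> nat \<Rightarrow> complex^8" where
  "vrow i j = xrow i + xrow j - xrow 7"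

definition xlab :: "nat \<Rightarrow> int list" where
  "xlab k = (if k = 0 then fH else id_rows 8 ! k)"

definition vlab :: "nat \<Rightarrow> nat \<Rightarrow> int list" where
  "vlab i j = row_add (row_add (xlab i) (xlab j)) (map ((*) (-1)) (xlab 7))"

definition nlab :: "nat \<Rightarrow> nat \<Rightarrow> int list" where
  "nlab i j = row_add (id_rows 8 ! 0) (map ((*) (-1)) (vlab i j))"

lemma phiH: "lin_comb basis8 fH = unitv 2"
  by (simp add: fH_def basis8_defs vec_eq_iff forall_8 vector_8)

lemma nat_le_7_cases: "k \<le> 7 \<Longrightarrow> k = 0 \<or> k = 1 \<or> k = 2 \<or> k = 3 \<or> k = 4 \<or> k = 5 \<or> k = 6 \<or> k = (7::nat)"
  by presburger

lemma lin_comb_xlab: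
  assumes "k \<le> 7"
  shows "lin_comb basis8 (xlab k) = xrow k"
proof (cases "k = 0")
  case True
  then show ?thesis
    by (simp add: xlab_def phiH xrow_def)
next
  case False
  then show ?thesis
    using nat_le_7_cases[OF assms]
    by (auto simp: xlab_def id_rows_8 basis8_def)
qed

lemma lin_comb_kap8: "lin_comb basis8 (id_rows 8 ! 0) = kap8"
  by (simp add: id_rows_8 basis8_def)

lemma lin_comb_vlab: "i \<le> 7 \<Longrightarrow> j \<le> 7 \<Longrightarrow> lin_comb basis8 (vlab i j) = vrow i j"
  by (simp add: vlab_def vrow_def lin_comb_row_add lin_comb_scale lin_comb_xlab)

lemma lin_comb_nlab: "i \<le> 7 \<Longrightarrow> j \<le> 7 \<Longrightarrow> lin_comb basis8 (nlab i j) = kap8 - vrow i j"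
  by (simp add: nlab_def lin_comb_row_add lin_comb_scale lin_comb_vlab lin_comb_kap8)

definition pairs :: "(nat \<times> nat) list" where
  "pairs = concat (map (\<lambda>i. map (Pair i) [Suc i..<8]) [0..<8])"

lemma set_pairs: "set pairs = {(i, j). i < j \<and> j \<le> 7}"
  by (fastforce simp: pairs_def image_iff)

text \<open>This evaluation shows that the v(i,j) and -v(i,j) are all the cosets.\<close>

lemma labels_H: "set (map (row_mult fH) repsH) =
  set (map (\<lambda>(i, j). vlab i j) pairs @ map (\<lambda>(i, j). nlab i j) pairs)"
  by code_simp

definition rowsetH :: "(complex^8) set" where
  "rowsetH = {vrow i j | i j. i < j \<and> j \<le> 7} \<union> {kap8 - vrow i j | i j. i < j \<and> j \<le> 7}"

lemma rowsetH: "(\<lambda>a. unitv 2 v* a) ` H.R = rowsetH"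
proof -
  have "(\<lambda>a. unitv 2 v* a) ` H.R =
      (\<lambda>(i, j). lin_comb basis8 (vlab i j)) ` set pairs \<union> (\<lambda>(i, j). lin_comb basis8 (nlab i j)) ` set pairs"
    using H.rows_eq unfolding phiH labels_H by (auto simp: image_iff split: prod.splits)
  also have "\<dots> = rowsetH"
    unfolding rowsetH_def set_pairs by (fastforce simp: lin_comb_vlab lin_comb_nlab image_iff)
  finally show ?thesis .
qed

abbreviation fibH :: "complex^8 \<Rightarrow> (complex^8^8) set" where
  "fibH \<equiv> fib HH (unitv 2)"

lemma rowsetH_realized: "r \<in> rowsetH \<Longrightarrow> \<exists>a \<in> HH. unitv 2 v* a = r"
  using H.reps unfolding rowsetH[symmetric] HH_eq by blast

text \<open>The defining condition constrains the second entry on \<open>W\<close> only; by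
  \<open>row_eqI_W\<close> it pins the second row itself.\<close>

lemma vpos_eq:
  assumes "i < j" "j \<le> 7"
  shows "vpos i j = fibH (vrow i j)"
  unfolding vpos_def HH_eq GG_eq phiH[symmetric]
proof (rule H.the_rcos)
  have eq: "(a *v w) $ 2 = app (unitv 2 v* a) w" for a :: "complex^8^8" and w
    by (simp add: app_vector_matrix_mult app_unitv)
  have vrow: "app (vrow i j) w = xc i w + xc j w - xc 7 w" for w
    by (simp add: vrow_def app_add app_diff app_xrow)
  have "vrow i j \<in> rowsetH"
    using assms by (auto simp: rowsetH_def)
  then obtain a where "a \<in> HH" "unitv 2 v* a = vrow i j"
    using rowsetH_realized by blast
  then have "a \<in> gen_grp (set gensH)" "\<forall>w\<in>W. (a *v w) $ 2 = xc i w + xc j w - xc 7 w"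
    by (simp_all add: eq vrow HH_eq)
  then show "\<exists>a\<in>gen_grp (set gensH). \<forall>w\<in>W. (a *v w) $ 2 = xc i w + xc j w - xc 7 w"
    by blast
  show "lin_comb basis8 fH v* a = vrow i j"
    if "\<forall>w\<in>W. (a *v w) $ 2 = xc i w + xc j w - xc 7 w" for a
    unfolding phiH by (rule row_eqI_W) (use that eq vrow in auto)
qed

lemma vneg_eq:
  assumes "i < j" "j \<le> 7"
  shows "vneg i j = fibH (kap8 - vrow i j)"
  unfolding vneg_def HH_eq GG_eq phiH[symmetric]
proof (rule H.the_rcos)
  have eq: "(a *v w) $ 2 = app (unitv 2 v* a) w" for a :: "complex^8^8" and w
    by (simp add: app_vector_matrix_mult app_unitv)
  have vrow: "app (kap8 - vrow i j) w = 1 + xc 7 w - xc i w - xc j w" if "w \<in> W" for w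
    using that by (simp add: vrow_def app_add app_diff app_xrow app_kap8)
  have "kap8 - vrow i j \<in> rowsetH"
    using assms by (auto simp: rowsetH_def)
  then obtain a where "a \<in> HH" "unitv 2 v* a = kap8 - vrow i j"
    using rowsetH_realized by blast
  then have "a \<in> gen_grp (set gensH)" "\<forall>w\<in>W. (a *v w) $ 2 = 1 + xc 7 w - xc i w - xc j w"
    by (simp_all add: eq vrow HH_eq)
  then show "\<exists>a\<in>gen_grp (set gensH). \<forall>w\<in>W. (a *v w) $ 2 = 1 + xc 7 w - xc i w - xc j w"
    by blast
  show "lin_comb basis8 fH v* a = kap8 - vrow i j"
    if "\<forall>w\<in>W. (a *v w) $ 2 = 1 + xc 7 w - xc i w - xc j w" for a
    unfolding phiH by (rule row_eqI_W) (use that eq vrow in auto)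
qed

section \<open>The 32 cosets of \<open>GJ\<close> in \<open>H1\<close>\<close>

definition strings :: "int list list" where
  "strings = concat (map (\<lambda>r. concat (map (\<lambda>q. [bs r @ bs q, negs (bs r @ bs q)]) [0..<4])) [0..<4])"

lemma set_strings:
  "s \<in> set strings \<longleftrightarrow> (\<exists>r q. r \<le> 3 \<and> q \<le> 3 \<and> (s = bs r @ bs q \<or> s = negs (bs r @ bs q)))"
proof -
  have "{0..<4::nat} = {..3}"
    by auto
  then show ?thesis
    by (simp add: strings_def) blast
qed

definition srow :: "int list \<Rightarrow> complex^7" where
  "srow s = lin_comb basis7 (1 # s)"

abbreviation fibJ :: "complex^7 \<Rightarrow> (complex^7^7) set" where
  "fibJ \<equiv> fib H1 (lin_comb basis7 fJ)"

abbreviation fibL :: "complex^7 \<Rightarrow> (complex^7^7) set" where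
  "fibL \<equiv> fib H1 (lin_comb basis7 fL)"

lemma labels_J: "set (map (row_mult fJ) repsJ) = set (map ((#) 1) strings)"
  by code_simp

lemma rowsetJ: "(\<lambda>a. lin_comb basis7 fJ v* a) ` J.R = srow ` set strings"
  unfolding J.rows_eq labels_J by (auto simp: srow_def)

lemma phiJ: "lin_comb basis7 fJ = 2 *s unitv 1"
  by (simp add: unitv_eq_lin_comb7 fJ_def)

lemma nat_le_3_cases: "k \<le> 3 \<Longrightarrow> k = 0 \<or> k = 1 \<or> k = 2 \<or> k = (3::nat)"
  by presburger

lemma app_srow:
  assumes "r \<le> 3" "q \<le> 3" "x \<in> V"
  shows "app (srow (bs r @ bs q)) x = 2 * (1 + Ac r x - Ec q x)"
    and "app (srow (negs (bs r @ bs q))) x = 2 * (Ec q x - Ac r x)"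
proof -
  \<comment> \<open>The equation of \<open>V\<close> eliminates the last coordinate; each choice of
    \<open>r\<close> and \<open>q\<close> then leaves a linear identity.\<close>
  have G: "x $ 7 = 1 + x $ 1 + x $ 2 + x $ 3 + x $ 4 - x $ 5 - x $ 6"
    using assms(3) by (simp add: V_def algebra_simps)
  show "app (srow (bs r @ bs q)) x = 2 * (1 + Ac r x - Ec q x)"
    using nat_le_3_cases[OF assms(1)] nat_le_3_cases[OF assms(2)]
    by (elim disjE) (simp_all add: srow_def bs_def basis7_defs Ac_def Ec_def app_def sum_7 vector_7 G field_simps)
  show "app (srow (negs (bs r @ bs q))) x = 2 * (Ec q x - Ac r x)"
    using nat_le_3_cases[OF assms(1)] nat_le_3_cases[OF assms(2)]
    by (elim disjE) (simp_all add: srow_def negs_def bs_def basis7_defs Ac_def Ec_def app_def sum_7 vector_7 G field_simps)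
qed

lemma Jcos_eq:
  assumes "s \<in> set strings"
  shows "Jcos s = fibJ (srow s)"
  unfolding Jcos_def H1_eq_gensJ GJ_eq
proof (rule J.the_rcos)
  let ?P = "\<lambda>b. (\<exists>r q. r \<le> 3 \<and> q \<le> 3 \<and> s = bs r @ bs q \<and> (\<forall>x\<in>V. (b *v x) $ 1 = 1 + Ac r x - Ec q x))
    \<or> (\<exists>r q. r \<le> 3 \<and> q \<le> 3 \<and> s = negs (bs r @ bs q) \<and> (\<forall>x\<in>V. (b *v x) $ 1 = Ec q x - Ac r x))"
  have eq: "app (lin_comb basis7 fJ v* b) x = 2 * (b *v x) $ 1" for b x
    by (simp add: phiJ app_vector_matrix_mult app_scale app_unitv)
  show "lin_comb basis7 fJ v* b = srow s" if "?P b" for b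
    by (rule row_eqI_V) (use that in \<open>auto simp: eq app_srow\<close>)
  have "srow s \<in> (\<lambda>a. lin_comb basis7 fJ v* a) ` J.R"
    using assms by (simp add: rowsetJ)
  then obtain b where b: "b \<in> gen_grp (set gensJ)" "lin_comb basis7 fJ v* b = srow s"
    using J.reps by auto
  have 2: "(b *v x) $ 1 = app (srow s) x / 2" for x
    using eq[of b x] b(2) by simp
  obtain r q where "r \<le> 3" "q \<le> 3" and s: "s = bs r @ bs q \<or> s = negs (bs r @ bs q)"
    using assms set_strings by blast
  then have "s = bs r @ bs q \<and> (\<forall>x\<in>V. (b *v x) $ 1 = 1 + Ac r x - Ec q x) \<or>
      s = negs (bs r @ bs q) \<and> (\<forall>x\<in>V. (b *v x) $ 1 = Ec q x - Ac r x)"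
    by (auto simp: 2 app_srow)
  then have "?P b"
    using \<open>r \<le> 3\<close> \<open>q \<le> 3\<close> by blast
  then show "\<exists>b \<in> gen_grp (set gensJ). ?P b"
    using b by blast
qed


section \<open>The 12 cosets of \<open>GL\<close> in \<open>H1\<close>\<close>

definition llab :: "int \<Rightarrow> int list" where
  "llab k = 1 # map (\<lambda>p. if int p = k then 2 else if int p = - k then -2 else 0) [1..<7]"

text \<open>The rows \<open>kap7\<close> plus or minus twice \<open>eps k\<close> form the orbit of
  the fixed row, which is the one with label 4. Barred labels carry the minus sign.\<close>

definition lrow :: "int \<Rightarrow> complex^7" where
  "lrow k = lin_comb basis7 (llab k)"

definition Llabels :: "int list" where
  "Llabels = [1, 2, 3, 4, 5, 6, -1, -2, -3, -4, -5, -6]"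

lemma labels_L: "set (map (row_mult fL) repsL) = set (map llab Llabels)"
  by code_simp

lemma rowsetL: "(\<lambda>a. lin_comb basis7 fL v* a) ` L.R = lrow ` set Llabels"
  unfolding L.rows_eq labels_L by (auto simp: lrow_def)

definition half_swap_rows :: "int list list" where
  "half_swap_rows = map ((!) (id_rows 7)) [0, 4, 5, 6, 1, 2, 3]"

definition neg_rows :: "int list list" where
  "neg_rows = (map (map uminus) (id_rows 7))[0 := [1, 0, 0, 0, 0, 0, 0]]"

lemma mult_vector_component:
  assumes "represents basis7 basis7 M b" "2 *s unitv i = lin_comb basis7 c"
  shows "(b *v x) $ i = app (lin_comb basis7 (row_mult c M)) x / 2"
proof -
  have "2 * (b *v x) $ i = app ((2 *s unitv i) v* b) x"
    by (simp add: app_vector_matrix_mult app_scale app_unitv)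
  then show ?thesis
    unfolding assms(2) lin_comb_vector_matrix_mult[OF assms(1)] by (simp add: mult.commute)
qed

text \<open>On \<open>V\<close> the map u_1 is the permutation exchanging \<open>eps p\<close> and
  \<open>eps (p + 3)\<close>. The word avoids position 0, the only generator with sign
  changes.\<close>

lemma half_swap_mem: "\<exists>b \<in> H1. \<forall>x\<in>V. b *v x = uL 1 x"
proof -
  let ?w = "[3, 2, 1, 4, 3, 5, 4, 2, 3] :: nat list"
  have "list_all (\<lambda>g. g < length rowsJ) ?w"
    by code_simp
  moreover have "foldl (\<lambda>M g. mat_mult M (rowsJ ! g)) (id_rows 7) ?w = half_swap_rows"
    by code_simp
  ultimately obtain b where b: "b \<in> H1" "represents basis7 basis7 half_swap_rows b"
    using J.word_realized[of ?w] unfolding length_basis H1_eq_gensJ by auto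
  have "b *v x = uL 1 x" if "x \<in> V" for x
  proof -
    have G: "x $ 7 = 1 + x $ 1 + x $ 2 + x $ 3 + x $ 4 - x $ 5 - x $ 6"
      using that by (simp add: V_def algebra_simps)
    show ?thesis
      by (simp add: unitv_eq_lin_comb7[THEN mult_vector_component[OF b(2)]] vec_eq_iff forall_7 uL_def Let_def vector_7 half_swap_rows_def id_rows_7 basis7_defs
          app_def sum_7 G field_simps)
  qed
  then show ?thesis
    using b by blast
qed

text \<open>On \<open>V\<close> this map is the central element of W(D6), which negates every
  \<open>eps p\<close> and fixes \<open>kap7\<close>.\<close>

lemma neg_mem:
  "\<exists>b \<in> H1. \<forall>x\<in>V. b *v x =
    vector [1 - x $ 1, 1 - x $ 2, 1 - x $ 3, 1 - x $ 4, 2 - x $ 5, 2 - x $ 6, 2 - x $ 7]"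
proof -
  \<comment> \<open>A reduced word for the longest element; its 30 letters match the 30 positive
    roots of D6.\<close>
  let ?w = "[1, 0, 3, 2, 0, 3, 2, 1, 2, 3, 0, 2, 5, 4, 3, 2, 0, 5, 4, 3, 2, 1, 2, 3, 4, 5, 0, 2, 3,
    4] :: nat list"
  have "list_all (\<lambda>g. g < length rowsJ) ?w"
    by code_simp
  moreover have "foldl (\<lambda>M g. mat_mult M (rowsJ ! g)) (id_rows 7) ?w = neg_rows"
    by code_simp
  ultimately obtain b where b: "b \<in> H1" "represents basis7 basis7 neg_rows b"
    using J.word_realized[of ?w] unfolding length_basis H1_eq_gensJ by auto
  have "b *v x =
      vector [1 - x $ 1, 1 - x $ 2, 1 - x $ 3, 1 - x $ 4, 2 - x $ 5, 2 - x $ 6, 2 - x $ 7]"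
    if "x \<in> V" for x
  proof -
    have G: "x $ 7 = 1 + x $ 1 + x $ 2 + x $ 3 + x $ 4 - x $ 5 - x $ 6"
      using that by (simp add: V_def algebra_simps)
    show ?thesis
      by (simp add: unitv_eq_lin_comb7[THEN mult_vector_component[OF b(2)]] vec_eq_iff forall_7 vector_7 neg_rows_def id_rows_7 basis7_defs
          app_def sum_7 G field_simps)
  qed
  then show ?thesis
    using b by blast
qed

lemma tr_mult_vector: "tr i j *v x = (\<chi> r. x $ Transposition.transpose i j r)"
  by (simp add: vec_eq_iff matrix_vector_mult_def tr_def if_distrib if_distribR cong: if_cong)

text \<open>Permuting the last three entries yields u_5 and u_6 from the identity u_4, and u_2 and
  u_3 from u_1. The barred maps follow by composing with the central element.\<close>

lemma uL_realized:
  assumes "k \<in> set Llabels"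
  shows "\<exists>b \<in> H1. \<forall>x\<in>V. b *v x = uL k x"
proof -
  have mult: "g ** h \<in> H1" if "g \<in> H1" "h \<in> H1" for g h
    using that unfolding H1_eq_gensJ by (rule gen_grp_mult)
  have tr: "tr 5 6 \<in> H1" "tr 6 7 \<in> H1"
    by (auto simp: H1_def intro: gen_grp_incl)
  have trans: "\<exists>b \<in> H1. \<forall>x\<in>V. b *v x = uL k' x"
    if "g \<in> H1" "\<And>x. g *v uL k x = uL k' x" "\<exists>b \<in> H1. \<forall>x\<in>V. b *v x = uL k x" for g k k'
    using that mult by (metis matrix_vector_mul_assoc)
  have "mat 1 \<in> H1"
    by (simp add: H1_def gen_one)
  then have 4: "\<exists>b \<in> H1. \<forall>x\<in>V. b *v x = uL 4 x"
    by (rule bexI[rotated]) (simp add: uL_def Let_def vec_eq_iff forall_7 vector_7)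
  have 5: "\<exists>b \<in> H1. \<forall>x\<in>V. b *v x = uL 5 x"
    by (rule trans[OF tr(1) _ 4])
      (simp add: tr_mult_vector uL_def Let_def vec_eq_iff forall_7 vector_7 Transposition.transpose_def)
  have 6: "\<exists>b \<in> H1. \<forall>x\<in>V. b *v x = uL 6 x"
    by (rule trans[OF mult[OF mult[OF tr(1) tr(2)] tr(1)] _ 4])
      (simp add: matrix_vector_mul_assoc[symmetric] tr_mult_vector uL_def Let_def vec_eq_iff forall_7
        vector_7 Transposition.transpose_def)
  have 2: "\<exists>b \<in> H1. \<forall>x\<in>V. b *v x = uL 2 x"
    by (rule trans[OF tr(1) _ half_swap_mem])
      (simp add: tr_mult_vector uL_def Let_def vec_eq_iff forall_7 vector_7 Transposition.transpose_def)
  have 3: "\<exists>b \<in> H1. \<forall>x\<in>V. b *v x = uL 3 x"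
    by (rule trans[OF mult[OF tr(1) tr(2)] _ half_swap_mem])
      (simp add: matrix_vector_mul_assoc[symmetric] tr_mult_vector uL_def Let_def vec_eq_iff forall_7
        vector_7 Transposition.transpose_def)
  have pos: "\<exists>b \<in> H1. \<forall>x\<in>V. b *v x = uL k x" if "k \<in> {1, 2, 3, 4, 5, 6}" for k
    using that half_swap_mem 2 3 4 5 6 by blast
  obtain n where n: "n \<in> H1" "\<And>x. x \<in> V \<Longrightarrow> n *v x =
      vector [1 - x $ 1, 1 - x $ 2, 1 - x $ 3, 1 - x $ 4, 2 - x $ 5, 2 - x $ 6, 2 - x $ 7]"
    using neg_mem by blast
  have neg: "\<exists>b \<in> H1. \<forall>x\<in>V. b *v x = uL (- k) x" if k: "k \<in> {1, 2, 3, 4, 5, 6}" for k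
  proof -
    obtain b where b: "b \<in> H1" "\<And>x. x \<in> V \<Longrightarrow> b *v x = uL k x"
      using pos[OF k] by blast
    have "(n ** b) *v x = uL (- k) x" if "x \<in> V" for x
    proof -
      \<comment> \<open>The formula for \<open>n\<close> is available on \<open>V\<close> only, so
        the inner vector must lie there.\<close>
      have "uL k x \<in> V"
        using k that by (elim insertE emptyE) (simp_all add: uL_def Let_def V_def vector_7 algebra_simps)
      then have "(n ** b) *v x = vector [1 - uL k x $ 1, 1 - uL k x $ 2, 1 - uL k x $ 3,
          1 - uL k x $ 4, 2 - uL k x $ 5, 2 - uL k x $ 6, 2 - uL k x $ 7]"
        using b n that by (simp add: matrix_vector_mul_assoc[symmetric])
      also have "\<dots> = uL (- k) x"
        using k by (elim insertE emptyE) (simp_all add: uL_def Let_def vector_7 vec_eq_iff forall_7)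
      finally show ?thesis .
    qed
    then show ?thesis
      using mult n b by blast
  qed
  show ?thesis
    using assms pos[of k] neg[of "- k"] by (auto simp: Llabels_def)
qed

lemma app_lrow:
  assumes "k \<in> set Llabels" "x \<in> V"
  shows "app (lin_comb basis7 fL) (uL k x) = app (lrow k) x"
proof -
  have G: "x $ 7 = 1 + x $ 1 + x $ 2 + x $ 3 + x $ 4 - x $ 5 - x $ 6"
    using assms(2) by (simp add: V_def algebra_simps)
  have "[1..<7] = [1, 2, 3, 4, 5, 6]"
    by code_simp
  then show ?thesis
    using assms(1) unfolding Llabels_def
    by (auto simp: lrow_def llab_def fL_def uL_def Let_def basis7_defs app_def sum_7 vector_7 G field_simps)
qed

lemma Lcos_eq:
  assumes "k \<in> set Llabels"
  shows "Lcos k = fibL (lrow k)"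
  unfolding Lcos_def H1_eq_gensL GL_eq
proof (rule L.the_rcos)
  show "\<exists>b\<in>gen_grp (set gensL). \<forall>x\<in>V. b *v x = uL k x"
    using uL_realized[OF assms] by (simp add: H1_eq_gensL)
  show "lin_comb basis7 fL v* b = lrow k" if "\<forall>x\<in>V. b *v x = uL k x" for b
    by (rule row_eqI_V) (use that assms in \<open>simp add: app_vector_matrix_mult app_lrow\<close>)
qed

section \<open>The map on cosets\<close>

definition color :: "complex^8 \<Rightarrow> complex" where
  "color r = r $ 2 - r $ 8"

lemma color_eq_color_mat: "r v* color_mat = (2 * color r) *s (unitv 2 - unitv 8)"
  by (simp add: vec_eq_iff forall_8 vector_matrix_mult_def sum_8 color_mat_def vector_8 color_def
      unitv_def algebra_simps)

lemma intertwined_color: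
  assumes "intertwined a h"
  shows "color (r v* a) = color r"
proof -
  have "(r v* a) v* color_mat = r v* color_mat"
    using assms by (simp add: intertwined_def vector_matrix_mul_assoc)
  then have "((2 * color (r v* a)) *s (unitv 2 - unitv 8)) $ (2::8) =
      ((2 * color r) *s (unitv 2 - unitv 8)) $ (2::8)"
    by (simp only: color_eq_color_mat)
  then show ?thesis
    by (simp add: unitv_def)
qed

text \<open>The color restores what \<open>down\<close> forgets, so \<open>down\<close> is injective
  on rows of one color although blue and red rows share images.\<close>

lemma down_inj:
  assumes "color r = color r'" "r v* down = r' v* down"
  shows "r = r'"
proof -
  have "r v* (down ** up + color_mat) = r' v* (down ** up + color_mat)"
    using assms
    by (simp add: vector_matrix_mult_add_rdistrib vector_matrix_mul_assoc[symmetric] color_eq_color_mat)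
  then have "r v* mat 4 = r' v* mat 4"
    by (simp add: down_up)
  then show ?thesis
    by (simp add: vec_eq_iff vector_matrix_mult_def mat_def if_distrib[of "(*) _"] cong: if_cong)
qed

lemma color_vrow: "color (vrow i j) = color (xrow i) + color (xrow j) - color (xrow 7)"
  by (simp add: color_def vrow_def)

lemma color_xrow:
  assumes "k \<le> 7"
  shows "color (xrow k) = (if k = 0 then 1 else if k = 1 then -1 else 0)"
  using nat_le_7_cases[OF assms] by (elim disjE) (simp_all add: color_def xrow_def unitv_def)

lemma color_neg: "color (kap8 - r) = - color r"
  by (simp add: color_def kap8_def vector_8)

definition jpairs :: "(nat \<times> nat) list" where
  "jpairs = filter (\<lambda>(i, j). 2 \<le> i) pairs"

lemma set_jpairs: "set jpairs = {(i, j). 2 \<le> i \<and> i < j \<and> j \<le> 7}"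
  by (auto simp: jpairs_def set_pairs)

text \<open>Checks the label table of \<open>gamma1\<close> against multiplication by
  \<open>down\<close>, here for the \<open>J\<close> cosets.\<close>

lemma down_labels_J:
  "list_all (\<lambda>(i, j). row_mult (vlab i j) down_rows = 1 # pstr i j \<and> pstr i j \<in> set strings \<and>
     row_mult (nlab i j) down_rows = 1 # negs (pstr i j) \<and> negs (pstr i j) \<in> set strings) jpairs"
  "row_mult (vlab 0 1) down_rows = 1 # [1, 1, 1, 1, 1, 1]"
  "row_mult (nlab 0 1) down_rows = 1 # [-1, -1, -1, -1, -1, -1]"
  "[1, 1, 1, 1, 1, 1] \<in> set strings" "[-1, -1, -1, -1, -1, -1] \<in> set strings"
  by code_simp+

text \<open>The same label results for i = 0 and i = 1, which is why a blue and a red coset share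
  each image.\<close>

lemma down_labels_L:
  "list_all (\<lambda>j. int j - 1 \<in> set Llabels \<and> - (int j - 1) \<in> set Llabels \<and>
     list_all (\<lambda>i. row_mult (vlab i j) down_rows = llab (int j - 1) \<and>
       row_mult (nlab i j) down_rows = llab (- (int j - 1))) [0, 1]) [2..<8]"
  by code_simp

lemma down_vlab:
  assumes "i \<le> 7" "j \<le> 7"
  shows "vrow i j v* down = lin_comb basis7 (row_mult (vlab i j) down_rows)"
    and "(kap8 - vrow i j) v* down = lin_comb basis7 (row_mult (nlab i j) down_rows)"
  using lin_comb_vector_matrix_mult[OF represents_down]
  by (simp add: lin_comb_vlab[OF assms, symmetric])
    (simp only: lin_comb_nlab[OF assms, symmetric] lin_comb_vector_matrix_mult[OF represents_down])

lemma down_J: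
  assumes "2 \<le> i" "i < j" "j \<le> 7"
  shows "vrow i j v* down = srow (pstr i j)" "(kap8 - vrow i j) v* down = srow (negs (pstr i j))"
    "pstr i j \<in> set strings" "negs (pstr i j) \<in> set strings"
proof -
  have "(i, j) \<in> set jpairs"
    using assms by (simp add: set_jpairs)
  then have "row_mult (vlab i j) down_rows = 1 # pstr i j" "pstr i j \<in> set strings"
    "row_mult (nlab i j) down_rows = 1 # negs (pstr i j)" "negs (pstr i j) \<in> set strings"
    using down_labels_J(1) by (auto simp: list_all_iff)
  then show "vrow i j v* down = srow (pstr i j)" "(kap8 - vrow i j) v* down = srow (negs (pstr i j))"
    "pstr i j \<in> set strings" "negs (pstr i j) \<in> set strings"
    using down_vlab[of i j] assms by (auto simp: srow_def)
qed

lemma down_01: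
  "vrow 0 1 v* down = srow [1, 1, 1, 1, 1, 1]"
  "(kap8 - vrow 0 1) v* down = srow [-1, -1, -1, -1, -1, -1]"
  using down_vlab[of 0 1] down_labels_J(2,3) by (simp_all add: srow_def)

lemma down_L:
  assumes "2 \<le> j" "j \<le> 7" "i \<le> 1"
  shows "vrow i j v* down = lrow (int j - 1)" "(kap8 - vrow i j) v* down = lrow (- (int j - 1))"
    "int j - 1 \<in> set Llabels" "- (int j - 1) \<in> set Llabels"
proof -
  have "j \<in> set [2..<8]" "i \<in> set [0, 1]"
    using assms by auto
  then have "row_mult (vlab i j) down_rows = llab (int j - 1)"
    "row_mult (nlab i j) down_rows = llab (- (int j - 1))"
    "int j - 1 \<in> set Llabels" "- (int j - 1) \<in> set Llabels"
    using down_labels_L unfolding list_all_iff by blast+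
  then show "vrow i j v* down = lrow (int j - 1)" "(kap8 - vrow i j) v* down = lrow (- (int j - 1))"
    "int j - 1 \<in> set Llabels" "- (int j - 1) \<in> set Llabels"
    using down_vlab[of i j] assms by (auto simp: lrow_def)
qed

text \<open>The map \<open>gamma1\<close> on rows: the color decides whether the image row names a
  coset of \<open>GJ\<close> or one of \<open>GL\<close>.\<close>

definition target :: "complex^8 \<Rightarrow> (complex^7^7) set" where
  "target r = (if color r = 0 then fibJ (r v* down) else fibL (r v* down))"

lemma target_J:
  assumes "2 \<le> i" "i < j" "j \<le> 7"
  shows "target (vrow i j) = Jcos (pstr i j)" "target (kap8 - vrow i j) = Jcos (negs (pstr i j))"
  using assms down_J[OF assms]
  by (simp_all add: target_def color_neg color_vrow color_xrow Jcos_eq)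

lemma target_01:
  "target (vrow 0 1) = Jcos [1, 1, 1, 1, 1, 1]"
  "target (kap8 - vrow 0 1) = Jcos [-1, -1, -1, -1, -1, -1]"
  using down_01 by (simp_all add: target_def color_neg color_vrow color_xrow Jcos_eq down_labels_J)

lemma target_L:
  assumes "2 \<le> j" "j \<le> 7" "i \<le> 1"
  shows "target (vrow i j) = Lcos (int j - 1)" "target (kap8 - vrow i j) = Lcos (- (int j - 1))"
proof -
  have "color (vrow i j) \<noteq> 0"
    using assms by (auto simp: color_vrow color_xrow)
  then show "target (vrow i j) = Lcos (int j - 1)" "target (kap8 - vrow i j) = Lcos (- (int j - 1))"
    using down_L[OF assms] Lcos_eq[of "int j - 1"] Lcos_eq[of "- (int j - 1)"]
    by (simp_all add: target_def color_neg)
qed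

lemma fibH_inj:
  assumes "r \<in> rowsetH" "r' \<in> rowsetH" "fibH r = fibH r'"
  shows "r = r'"
  using H.fib_inj assms unfolding phiH rowsetH HH_eq inj_on_def by blast

lemma pair_cases:
  assumes "i < j" "j \<le> (7::nat)"
  obtains "i = 0" "j = 1" | "i \<le> 1" "2 \<le> j" | "2 \<le> i"
  using assms by linarith

text \<open>\<open>gamma1\<close> is defined by overlapping descriptions of a coset. As
  \<open>fibH\<close> is injective on coset rows, every clause that applies speaks of the same row
  and yields \<open>target r\<close>.\<close>

lemma gamma1_fibH:
  assumes "r \<in> rowsetH"
  shows "gamma1 (fibH r) = target r"
proof -
  let ?P = "\<lambda>K. (\<exists>j. 2 \<le> j \<and> j \<le> 7 \<and> (fibH r = vpos 0 j \<or> fibH r = vpos 1 j) \<and> K = Lcos (int j - 1))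
     \<or> (\<exists>j. 2 \<le> j \<and> j \<le> 7 \<and> (fibH r = vneg 1 j \<or> fibH r = vneg 0 j) \<and> K = Lcos (- (int j - 1)))
     \<or> (fibH r = vpos 0 1 \<and> K = Jcos [1,1,1,1,1,1])
     \<or> (fibH r = vneg 0 1 \<and> K = Jcos [-1,-1,-1,-1,-1,-1])
     \<or> (\<exists>i j. 2 \<le> i \<and> i < j \<and> j \<le> 7 \<and> fibH r = vpos i j \<and> K = Jcos (pstr i j))
     \<or> (\<exists>i j. 2 \<le> i \<and> i < j \<and> j \<le> 7 \<and> fibH r = vneg i j \<and> K = Jcos (negs (pstr i j)))"
  have pos: "r = vrow i j" if "i < j" "j \<le> 7" "fibH r = vpos i j" for i j
    using that assms vpos_eq[of i j] by (intro fibH_inj) (auto simp: rowsetH_def)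
  have neg: "r = kap8 - vrow i j" if "i < j" "j \<le> 7" "fibH r = vneg i j" for i j
    using that assms vneg_eq[of i j] by (intro fibH_inj) (auto simp: rowsetH_def)
  have "K = target r" if "?P K" for K
    using that
  proof (elim disjE exE conjE)
    show ?thesis if "2 \<le> j" "j \<le> 7" "fibH r = vpos 0 j" "K = Lcos (int j - 1)" for j
      using that pos[of 0 j] target_L(1)[of j 0] by simp
    show ?thesis if "2 \<le> j" "j \<le> 7" "fibH r = vpos 1 j" "K = Lcos (int j - 1)" for j
      using that pos[of 1 j] target_L(1)[of j 1] by simp
    show ?thesis if "2 \<le> j" "j \<le> 7" "fibH r = vneg 1 j" "K = Lcos (- (int j - 1))" for j
      using that neg[of 1 j] target_L(2)[of j 1] by simp
    show ?thesis if "2 \<le> j" "j \<le> 7" "fibH r = vneg 0 j" "K = Lcos (- (int j - 1))" for j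
      using that neg[of 0 j] target_L(2)[of j 0] by simp
    show ?thesis if "fibH r = vpos 0 1" "K = Jcos [1,1,1,1,1,1]"
      using that pos[of 0 1] target_01 by simp
    show ?thesis if "fibH r = vneg 0 1" "K = Jcos [-1,-1,-1,-1,-1,-1]"
      using that neg[of 0 1] target_01 by simp
    show ?thesis if "2 \<le> i" "i < j" "j \<le> 7" "fibH r = vpos i j" "K = Jcos (pstr i j)" for i j
      using that pos[of i j] target_J[of i j] by simp
    show ?thesis if "2 \<le> i" "i < j" "j \<le> 7" "fibH r = vneg i j" "K = Jcos (negs (pstr i j))" for i j
      using that neg[of i j] target_J[of i j] by simp
  qed
  moreover have "?P (target r)"
  proof -
    obtain i j where ij: "i < j" "j \<le> 7" and r: "r = vrow i j \<or> r = kap8 - vrow i j"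
      using assms by (auto simp: rowsetH_def)
    note eqs = vpos_eq[OF ij] vneg_eq[OF ij]
    from ij show ?thesis
    proof (cases rule: pair_cases)
      case 1
      then show ?thesis
        using r eqs target_01 by metis
    next
      case 2
      then have "i = 0 \<or> i = 1"
        by auto
      then show ?thesis
        using 2 r ij eqs target_L[of j i] by metis
    next
      case 3
      then show ?thesis
        using r ij eqs target_J[of i j] by metis
    qed
  qed
  ultimately show ?thesis
    unfolding gamma1_def by (intro the_equality)
qed

section \<open>Equivariance\<close>

lemma rcosets_H: "rcosets_of GG HH = fibH ` rowsetH"
  using H.rcosets_eq unfolding phiH rowsetH GG_eq HH_eq .

lemma rcosets_J: "rcosets_of GJ H1 = fibJ ` srow ` set strings"
  using J.rcosets_eq unfolding rowsetJ GJ_eq H1_eq_gensJ .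

lemma rcosets_L: "rcosets_of GL H1 = fibL ` lrow ` set Llabels"
  using L.rcosets_eq unfolding rowsetL GL_eq H1_eq_gensL .

lemma act_fibH: "a \<in> HH \<Longrightarrow> act a (fibH r) = fibH (r v* matrix_inv a)"
  unfolding HH_eq by (rule act_fib[OF H.involutive])

lemma act_fib_H1: "a \<in> H1 \<Longrightarrow> act a (fib H1 phi r) = fib H1 phi (r v* matrix_inv a)"
  unfolding H1_eq_gensJ by (rule act_fib[OF J.involutive])

lemma rowsetH_mult:
  assumes "r \<in> rowsetH" "a \<in> HH"
  shows "r v* a \<in> rowsetH"
proof -
  obtain b where "b \<in> HH" "unitv 2 v* b = r"
    using rowsetH_realized assms(1) by blast
  then have "unitv 2 v* (b ** a) = r v* a" "b ** a \<in> gen_grp (set gensH)"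
    using assms(2) by (auto simp: vector_matrix_mul_assoc HH_eq intro: gen_grp_mult)
  then show ?thesis
    using H.rows unfolding phiH rowsetH by (metis imageI)
qed

lemma QQ_inverse:
  assumes "a \<in> QQ"
  shows "matrix_inv a \<in> QQ" "mm (matrix_inv a) = matrix_inv (mm a)"
proof -
  note a = gen_grp_inverse[OF involutive_Q assms[unfolded QQ_def]]
  show Q: "matrix_inv a \<in> QQ"
    using a by (simp add: QQ_def)
  have "mm (mat 1) = mat 1"
    using mm_intertwined[of "mat 1"] intertwined_one intertwined_unique_right
    by (simp add: QQ_def gen_one)
  then have "mm a ** mm (matrix_inv a) = mat 1" "mm (matrix_inv a) ** mm a = mat 1"
    using a mm_isomorphism assms Q by metis+
  then show "mm (matrix_inv a) = matrix_inv (mm a)"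
    by (simp add: matrix_inv_unique)
qed

text \<open>Intertwining moves the inverse of \<open>a\<close> past \<open>down\<close>, and the
  color is kept, so both sides fall into the same branch of \<open>target\<close>.\<close>

lemma target_mult:
  assumes "a \<in> QQ"
  shows "target (r v* matrix_inv a) = act (mm a) (target r)"
proof -
  have i: "intertwined (matrix_inv a) (matrix_inv (mm a))"
    using mm_intertwined[OF QQ_inverse(1)[OF assms]] by (simp add: QQ_inverse(2)[OF assms])
  have "(r v* matrix_inv a) v* down = (r v* down) v* matrix_inv (mm a)"
    using i by (simp add: intertwined_def vector_matrix_mul_assoc)
  then show ?thesis
    using act_fib_H1[OF mm_mem[OF assms]] intertwined_color[OF i] by (simp add: target_def)
qed

section \<open>Blue, red and \<open>J\<close> cosets as color classes\<close>

definition color_class :: "complex \<Rightarrow> (complex^8) set" where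
  "color_class c = {r \<in> rowsetH. color r = c}"

lemma color_class_mult:
  assumes "a \<in> QQ" "t \<in> fibH ` color_class c"
  shows "act a t \<in> fibH ` color_class c"
proof -
  obtain r where r: "r \<in> color_class c" "t = fibH r"
    using assms(2) by blast
  note Q = QQ_inverse(1)[OF assms(1)]
  have "r v* matrix_inv a \<in> color_class c"
    using r rowsetH_mult[of r "matrix_inv a"] Q QQ_subset_HH intertwined_color[OF mm_intertwined[OF Q]]
    by (auto simp: color_class_def)
  then show ?thesis
    using r act_fibH assms(1) QQ_subset_HH by blast
qed

lemma color_class_values:
  assumes "i < j" "j \<le> 7"
  shows "color (vrow i j) = (if i = 0 \<and> j \<noteq> 1 then 1 else if i = 1 then -1 else 0)"
  using assms by (auto simp: color_vrow color_xrow)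

lemma color_class_iff:
  "r \<in> color_class c \<longleftrightarrow> (\<exists>i j. i < j \<and> j \<le> 7 \<and>
    (r = vrow i j \<and> c = (if i = 0 \<and> j \<noteq> 1 then 1 else if i = 1 then -1 else 0) \<or>
     r = kap8 - vrow i j \<and> c = (if i = 0 \<and> j \<noteq> 1 then -1 else if i = 1 then 1 else 0)))"
proof -
  have "r \<in> color_class c \<longleftrightarrow> (\<exists>i j. i < j \<and> j \<le> 7 \<and>
    (r = vrow i j \<and> c = color (vrow i j) \<or> r = kap8 - vrow i j \<and> c = - color (vrow i j)))"
    unfolding color_class_def rowsetH_def color_neg[symmetric] by blast
  then show ?thesis
    by (simp add: color_class_values if_distrib[of uminus] cong: conj_cong if_cong)
qed

lemma color_class_1: "color_class 1 = vrow 0 ` {2..7} \<union> (\<lambda>j. kap8 - vrow 1 j) ` {2..7}"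
proof (intro equalityI subsetI)
  fix r assume "r \<in> color_class 1"
  then obtain i j where "i < j" "j \<le> 7" "r = vrow i j \<and> i = 0 \<and> j \<noteq> 1 \<or> r = kap8 - vrow i j \<and> i = 1"
    unfolding color_class_iff by (auto split: if_splits)
  then show "r \<in> vrow 0 ` {2..7} \<union> (\<lambda>j. kap8 - vrow 1 j) ` {2..7}"
    by (auto intro!: imageI)
next
  fix r assume "r \<in> vrow 0 ` {2..7} \<union> (\<lambda>j. kap8 - vrow 1 j) ` {2..7}"
  then obtain j where "2 \<le> j" "j \<le> 7" "r = vrow 0 j \<or> r = kap8 - vrow 1 j"
    by auto
  then show "r \<in> color_class 1"
    unfolding color_class_iff by (intro exI[of _ "if r = vrow 0 j then 0 else 1"] exI[of _ j]) auto
qed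

lemma color_class_minus_1: "color_class (-1) = vrow 1 ` {2..7} \<union> (\<lambda>j. kap8 - vrow 0 j) ` {2..7}"
proof (intro equalityI subsetI)
  fix r assume "r \<in> color_class (-1)"
  then obtain i j where "i < j" "j \<le> 7" "r = vrow i j \<and> i = 1 \<or> r = kap8 - vrow i j \<and> i = 0 \<and> j \<noteq> 1"
    unfolding color_class_iff by (auto split: if_splits)
  then show "r \<in> vrow 1 ` {2..7} \<union> (\<lambda>j. kap8 - vrow 0 j) ` {2..7}"
    by (auto intro!: imageI)
next
  fix r assume "r \<in> vrow 1 ` {2..7} \<union> (\<lambda>j. kap8 - vrow 0 j) ` {2..7}"
  then obtain j where "2 \<le> j" "j \<le> 7" "r = vrow 1 j \<or> r = kap8 - vrow 0 j"
    by auto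
  then show "r \<in> color_class (-1)"
    unfolding color_class_iff by (intro exI[of _ "if r = vrow 1 j then 1 else 0"] exI[of _ j]) auto
qed

lemma color_class_0: "color_class 0 = {vrow 0 1, kap8 - vrow 0 1} \<union>
    (\<lambda>(i, j). vrow i j) ` set jpairs \<union> (\<lambda>(i, j). kap8 - vrow i j) ` set jpairs"
proof (intro equalityI subsetI)
  fix r assume "r \<in> color_class 0"
  then obtain i j where "i < j" "j \<le> 7" "i = 0 \<and> j = 1 \<or> 2 \<le> i" "r = vrow i j \<or> r = kap8 - vrow i j"
    unfolding color_class_iff by (auto split: if_splits)
  then consider "i = 0" "j = 1" | "(i, j) \<in> set jpairs"
    by (auto simp: set_jpairs)
  then show "r \<in> {vrow 0 1, kap8 - vrow 0 1} \<union>
    (\<lambda>(i, j). vrow i j) ` set jpairs \<union> (\<lambda>(i, j). kap8 - vrow i j) ` set jpairs"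
    using \<open>r = vrow i j \<or> r = kap8 - vrow i j\<close>
    by cases (auto intro: image_eqI[where x = "(i, j)"])
next
  fix r assume "r \<in> {vrow 0 1, kap8 - vrow 0 1} \<union>
    (\<lambda>(i, j). vrow i j) ` set jpairs \<union> (\<lambda>(i, j). kap8 - vrow i j) ` set jpairs"
  then obtain i j where "i < j" "j \<le> 7" "i = 0 \<and> j = 1 \<or> 2 \<le> i" "r = vrow i j \<or> r = kap8 - vrow i j"
    unfolding set_jpairs by fastforce
  then show "r \<in> color_class 0"
    unfolding color_class_iff by (intro exI[of _ i] exI[of _ j]) auto
qed

lemma O1_eq: "O1 = fibH ` color_class 1"
proof -
  have "O1 = vpos 0 ` {2..7} \<union> vneg 1 ` {2..7}"
    unfolding O1_def by auto
  also have "vpos 0 ` {2..7} = fibH ` vrow 0 ` {2..7}"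
    unfolding image_image by (rule image_cong) (auto simp: vpos_eq)
  also have "vneg 1 ` {2..7} = fibH ` (\<lambda>j. kap8 - vrow 1 j) ` {2..7}"
    unfolding image_image by (rule image_cong) (auto simp: vneg_eq)
  finally show ?thesis
    by (simp only: color_class_1 image_Un)
qed

lemma O2_eq: "O2 = fibH ` color_class (-1)"
proof -
  have "O2 = vpos 1 ` {2..7} \<union> vneg 0 ` {2..7}"
    unfolding O2_def by auto
  also have "vpos 1 ` {2..7} = fibH ` vrow 1 ` {2..7}"
    unfolding image_image by (rule image_cong) (auto simp: vpos_eq)
  also have "vneg 0 ` {2..7} = fibH ` (\<lambda>j. kap8 - vrow 0 j) ` {2..7}"
    unfolding image_image by (rule image_cong) (auto simp: vneg_eq)
  finally show ?thesis
    by (simp only: color_class_minus_1 image_Un)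
qed

lemma O3_eq: "O3 = fibH ` color_class 0"
proof -
  have "O3 = {vpos 0 1, vneg 0 1} \<union>
      (\<lambda>(i, j). vpos i j) ` set jpairs \<union> (\<lambda>(i, j). vneg i j) ` set jpairs"
    unfolding O3_def set_jpairs by auto
  also have "(\<lambda>(i, j). vpos i j) ` set jpairs = fibH ` (\<lambda>(i, j). vrow i j) ` set jpairs"
    unfolding image_image by (rule image_cong) (auto simp: vpos_eq set_jpairs)
  also have "(\<lambda>(i, j). vneg i j) ` set jpairs = fibH ` (\<lambda>(i, j). kap8 - vrow i j) ` set jpairs"
    unfolding image_image by (rule image_cong) (auto simp: vneg_eq set_jpairs)
  also have "{vpos 0 1, vneg 0 1} = fibH ` {vrow 0 1, kap8 - vrow 0 1}"
    using vpos_eq[of 0 1] vneg_eq[of 0 1] by simp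
  finally show ?thesis
    by (simp only: color_class_0 image_Un)
qed

text \<open>Injectivity combines that of \<open>F\<close> with \<open>down_inj\<close>. The
  parameter \<open>F\<close> is \<open>fibL\<close> for the blue and red cosets and
  \<open>fibJ\<close> for the \<open>J\<close> cosets.\<close>

lemma bij_betw_gamma1:
  assumes "\<And>r. r \<in> color_class c \<Longrightarrow> target r = F (r v* down)"
    and "inj_on F S" "(\<lambda>r. r v* down) ` color_class c = S"
  shows "bij_betw gamma1 (fibH ` color_class c) (F ` S)"
proof (rule bij_betw_imageI)
  have eq: "gamma1 (fibH r) = F (r v* down)" if "r \<in> color_class c" for r
    using that assms(1) gamma1_fibH by (auto simp: color_class_def)
  show "gamma1 ` fibH ` color_class c = F ` S"
    using eq assms(3) by (auto simp: image_iff)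
  show "inj_on gamma1 (fibH ` color_class c)"
  proof (rule inj_onI, clarify)
    fix r r' assume r: "r \<in> color_class c" "r' \<in> color_class c"
      and g: "gamma1 (fibH r) = gamma1 (fibH r')"
    then have "F (r v* down) = F (r' v* down)"
      by (simp add: eq)
    then have "r v* down = r' v* down"
      by (rule inj_onD[OF assms(2)]) (use r assms(3) in auto)
    then show "fibH r = fibH r'"
      using r down_inj[of r r'] by (simp add: color_class_def)
  qed
qed

lemma set_Llabels:
  "set Llabels = (\<lambda>j. int j - 1) ` {2..7} \<union> (\<lambda>j. - (int j - 1)) ` {2..7}"
proof -
  have "{2..7} = {2, 3, 4, 5, 6, 7 :: nat}"
    by auto
  then show ?thesis
    by (auto simp: Llabels_def)
qed

text \<open>In each color one of the indices 0 and 1 yields the six plain labels and the other the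
  six barred ones.\<close>

lemma down_color_class_L:
  assumes "c = 1 \<or> c = -1"
  shows "(\<lambda>r. r v* down) ` color_class c = lrow ` set Llabels"
proof -
  have *: "(\<lambda>j. vrow i j v* down) ` {2..7} = (\<lambda>j. lrow (int j - 1)) ` {2..7}"
    "(\<lambda>j. (kap8 - vrow i j) v* down) ` {2..7} = (\<lambda>j. lrow (- (int j - 1))) ` {2..7}"
    if "i \<le> 1" for i
    using that by (intro image_cong refl down_L; simp)+
  from assms show ?thesis
    by (elim disjE) (simp_all only: color_class_1 color_class_minus_1 set_Llabels image_Un image_image
        *[OF le0] *[OF order_refl])
qed

text \<open>Gives surjectivity onto the cosets of \<open>GJ\<close>: the strings assigned to the
  \<open>J\<close> cosets are all the admissible ones.\<close>

lemma strings_eq: "set strings = set ([1, 1, 1, 1, 1, 1] # [-1, -1, -1, -1, -1, -1] #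
    map (\<lambda>(i, j). pstr i j) jpairs @ map (\<lambda>(i, j). negs (pstr i j)) jpairs)"
  by code_simp

lemma down_color_class_J: "(\<lambda>r. r v* down) ` color_class 0 = srow ` set strings"
proof -
  have "(\<lambda>x. (case x of (i, j) \<Rightarrow> vrow i j) v* down) ` set jpairs =
      (\<lambda>x. srow (case x of (i, j) \<Rightarrow> pstr i j)) ` set jpairs"
    by (rule image_cong) (auto simp: set_jpairs down_J)
  moreover have "(\<lambda>x. (case x of (i, j) \<Rightarrow> kap8 - vrow i j) v* down) ` set jpairs =
      (\<lambda>x. srow (case x of (i, j) \<Rightarrow> negs (pstr i j))) ` set jpairs"
    by (rule image_cong) (auto simp: set_jpairs down_J)
  ultimately show ?thesis
    unfolding color_class_0 strings_eq image_Un image_image set_append set_map list.set image_insert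
      image_empty down_01
    by blast
qed

theorem theorem5p5:
  shows "(\<forall>t\<in>rcosets_of GG HH. \<forall>a\<in>QQ. gamma1 (act a t) = act (mm a) (gamma1 t))
    \<and> bij_betw mm QQ H1 \<and> (\<forall>x\<in>QQ. \<forall>y\<in>QQ. mm (x ** y) = mm x ** mm y)
    \<and> (\<forall>a\<in>QQ. \<forall>t\<in>O1. act a t \<in> O1) \<and> bij_betw gamma1 O1 (rcosets_of GL H1)
    \<and> (\<forall>a\<in>QQ. \<forall>t\<in>O2. act a t \<in> O2) \<and> bij_betw gamma1 O2 (rcosets_of GL H1)
    \<and> (\<forall>a\<in>QQ. \<forall>t\<in>O3. act a t \<in> O3) \<and> bij_betw gamma1 O3 (rcosets_of GJ H1)"
proof -
  have equivariant: "gamma1 (act a t) = act (mm a) (gamma1 t)"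
    if t: "t \<in> rcosets_of GG HH" and a: "a \<in> QQ" for t a
  proof -
    obtain r where r: "r \<in> rowsetH" "t = fibH r"
      using t by (auto simp: rcosets_H)
    have "r v* matrix_inv a \<in> rowsetH"
      using r rowsetH_mult QQ_inverse(1)[OF a] QQ_subset_HH by blast
    then show ?thesis
      using r a act_fibH[of a r] QQ_subset_HH target_mult[OF a] gamma1_fibH by auto
  qed
  have injL: "inj_on fibL (lrow ` set Llabels)"
    using L.fib_inj unfolding rowsetL H1_eq_gensL .
  have injJ: "inj_on fibJ (srow ` set strings)"
    using J.fib_inj unfolding rowsetJ H1_eq_gensJ .
  \<comment> \<open>Blue and red are treated at once, since \<open>target\<close> only asks whether
    the color is nonzero.\<close>
  have L: "bij_betw gamma1 (fibH ` color_class c) (rcosets_of GL H1)" if "c = 1 \<or> c = -1" for c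
    unfolding rcosets_L
    by (rule bij_betw_gamma1[OF _ injL down_color_class_L[OF that]])
      (use that in \<open>auto simp: target_def color_class_def\<close>)
  have J: "bij_betw gamma1 (fibH ` color_class 0) (rcosets_of GJ H1)"
    unfolding rcosets_J
    by (rule bij_betw_gamma1[OF _ injJ down_color_class_J]) (simp add: target_def color_class_def)
  show ?thesis
    using equivariant mm_isomorphism L[of 1] L[of "-1"] J color_class_mult
    unfolding O1_eq O2_eq O3_eq by blast
qed

end
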